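(* Let $q=p^m$ be a power of a prime $p$, and let $\mathcal Q\subseteq \mathcal H_{Q_{[n]}}\otimes \mathcal H_{B_{[c]}}$ be an entanglement-assisted stabilizer code (EASC) with extended stabilizer group $S_{\rm EA}$ such that the Pauli label set $L(S_{\rm EA})\subseteq\mathbb F_q^{2(n+c)}$ is $\mathbb F_q$-linear. Let $r$ be an integer. Suppose that for every $i\in[n]$ there exist $G_i,K_i\in S_{\rm EA}$ with respective Pauli labels $${\rm lab}(G_i)=(\mathbf a_i,\mathbf r_i\mid\mathbf b_i,\mathbf s_i)\quad\text{and}\quad {\rm lab}(K_i)=(\mathbf u_i,\mathbf t_i\mid\mathbf v_i,\mathbf w_i),$$ where $\mathbf a_i,\mathbf b_i,\mathbf u_i,\mathbf v_i\in\mathbb F_q^n$ and $\mathbf r_i,\mathbf s_i,\mathbf t_i,\mathbf w_i\in\mathbb F_q^c$, such that 1) $\bigl((\mathbf a_i)_i,(\mathbf b_i)_i\bigr)=(1,0)$ and $\bigl((\mathbf u_i)_i,(\mathbf v_i)_i\bigr)=(0,1)$ (where $(\cdot)_i$ denotes the $i$-th coordinate); 2) $\bigl|(\mathrm{supp}_Q(G_i)\cup\mathrm{supp}_Q(K_i))\setminus\{i\}\bigr|\le r$. Then $\mathcal Q$ is an EAQLRC with locality $r$.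
   Context: Notation. $[m]=\{1,\dots,m\}$, $[0]=\emptyset$. A qudit has Hilbert space $\mathbb C^q$ with orthonormal basis $\{|x\rangle: x\in\mathbb F_q\}$. $Q_{[n]}=(Q_1,\dots,Q_n)$ is the transmitted register and $B_{[c]}=(B_1,\dots,B_c)$ is Bob's noiseless register; $\mathcal H_A$ is the tensor product of the qudit spaces in register $A$ ($\mathcal H_A=\mathbb C$ if $A$ is empty); for $R\subseteq[n]$, $Q_R$ is the subregister indexed by $R$. Paulis. Let ${\rm tr}:\mathbb F_q\to\mathbb F_p$ be the field trace, $\omega_p=e^{2\pi i/p}$, $X(a)|x\rangle=|x+a\rangle$, $Z(b)|x\rangle=\omega_p^{{\rm tr}(bx)}|x\rangle$. For a register $A$ of $t$ qudits and $\mathbf a,\mathbf b\in\mathbb F_q^t$, $X_A(\mathbf a)=\bigotimes_j X(a_j)$, $Z_A(\mathbf b)=\bigotimes_j Z(b_j)$, and $\mathcal G_A(q)=\{\omega_p^\ell X_A(\mathbf a)Z_A(\mathbf b):\mathbf a,\mathbf b\in\mathbb F_q^t,\ \ell\in\mathbb Z_p\}$. EAQECC. An EAQECC $\mathcal Q\subseteq\mathcal H_{Q_{[n]}}\otimes\mathcal H_{B_{[c]}}$ with parameters $[[n,\kappa,\delta;c]]_q$ ($0\le c\le n-\kappa$) is the image of an isometry $V:(\mathbb C^q)^{\otimes\kappa}\to(\mathbb C^q)^{\otimes n}\otimes(\mathbb C^q)^{\otimes c}$ of the form $V|\phi\rangle=q^{-c/2}\sum_{\mathbf x\in\mathbb F_q^c}U_{\rm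 enc}(|\phi\rangle\otimes|0\rangle^{\otimes(n-\kappa-c)}\otimes|\mathbf x\rangle)\otimes|\mathbf x\rangle_{B_{[c]}}$, with $U_{\rm enc}$ unitary on $n$ qudits; it has minimum distance $\delta$, meaning it can correct every set of erasures of at most $\delta-1$ transmitted qudits. EASC. An EASC is an EAQECC $\mathcal Q$ for which there is an abelian subgroup $S_{\rm EA}\subseteq\mathcal G_{Q_{[n]}\cup B_{[c]}}(q)$ (the extended stabilizer group) with $\mathcal Q=\{|\psi\rangle\in\mathcal H_{Q_{[n]}}\otimes\mathcal H_{B_{[c]}}: G|\psi\rangle=|\psi\rangle\ \forall G\in S_{\rm EA}\}$. For $G=\omega_p^\ell X_{Q_{[n]}}(\mathbf a)Z_{Q_{[n]}}(\mathbf b)\otimes X_{B_{[c]}}(\mathbf r)Z_{B_{[c]}}(\mathbf s)\in S_{\rm EA}$, its Pauli label is ${\rm lab}(G)=(\mathbf a,\mathbf r\mid\mathbf b,\mathbf s)\in\mathbb F_q^{2(n+c)}$ and $\mathrm{supp}_Q(G)=\{j\in[n]:(a_j,b_j)\ne(0,0)\}$. $L(S_{\rm EA})=\{{\rm lab}(G):G\in S_{\rm EA}\}$. Locality. For a register $A$, $\mathcal M(A)$ is the set of density operators on $\mathcal H_A$; a quantum channel is (the restriction to density operators of) a completely positive trace-preserving linear map. The erasure of qudit $i$ is $\Gamma_i(\rho)=\frac{I_{Q_i}}{q}\otimes{\rm Tr}_{Q_i}(\rho)$ for $\rho\in\mathcal M(Q_{[n]}\cup B_{[c]})$. A set $R\subseteq[n]\setminus\{i\}$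 is a recovery set for $Q_i$ if there is a quantum channel ${\rm Rec}_{i,R}:\mathcal M(Q_{\{i\}\cup R}\cup B_{[c]})\to\mathcal M(Q_{\{i\}\cup R}\cup B_{[c]})$ such that for every unit vector $|\psi\rangle\in\mathcal Q$, $({\rm Rec}_{i,R}\otimes{\rm id}_{Q_{[n]\setminus(\{i\}\cup R)}})(\Gamma_i(|\psi\rangle\langle\psi|))=|\psi\rangle\langle\psi|$. An EAQECC is an EAQLRC with locality $r$ if for every $i\in[n]$ there is a recovery set $R_i\subseteq[n]\setminus\{i\}$ for $Q_i$ with $|R_i|\le r$. *)

theory Defs
  imports
    Complex_Main
    "HOL-Library.FuncSet"
    "HOL-Library.Cardinality"
    "HOL-Computational_Algebra.Primes"
    "HOL-Algebra.Group"
begin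

section \<open>Linear algebra over a finite orthonormal basis\<close>

text \<open>
  A finite-dimensional Hilbert space with a fixed orthonormal basis indexed by a finite set \<open>I\<close> is
  represented by coordinate functions that vanish outside \<open>I\<close>, and linear operators on it by
  their matrix entries, \<open>M x y\<close> being the entry in row \<open>x\<close> and column \<open>y\<close>.
\<close>

definition vecs :: "'x set \<Rightarrow> ('x \<Rightarrow> complex) set" where
  "vecs I = {\<psi>. \<forall>x. x \<notin> I \<longrightarrow> \<psi> x = 0}"

definition ops :: "'x set \<Rightarrow> ('x \<Rightarrow> 'x \<Rightarrow> complex) set" where
  "ops I = {M. \<forall>x y. \<not> (x \<in> I \<and> y \<in> I) \<longrightarrow> M x y = 0}"

definition op_apply :: "'x set \<Rightarrow> ('x \<Rightarrow> 'x \<Rightarrow> complex) \<Rightarrow> ('x \<Rightarrow> complex) \<Rightarrow> 'x \<Rightarrow> complex" where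
  "op_apply I M \<psi> = (\<lambda>x. \<Sum>y\<in>I. M x y * \<psi> y)"

definition op_comp ::
  "'x set \<Rightarrow> ('x \<Rightarrow> 'x \<Rightarrow> complex) \<Rightarrow> ('x \<Rightarrow> 'x \<Rightarrow> complex) \<Rightarrow> 'x \<Rightarrow> 'x \<Rightarrow> complex" where
  "op_comp I M N = (\<lambda>x y. \<Sum>z\<in>I. M x z * N z y)"

definition op_id :: "'x set \<Rightarrow> 'x \<Rightarrow> 'x \<Rightarrow> complex" where
  "op_id I = (\<lambda>x y. if x \<in> I \<and> x = y then 1 else 0)"

definition op_adj :: "('x \<Rightarrow> 'x \<Rightarrow> complex) \<Rightarrow> 'x \<Rightarrow> 'x \<Rightarrow> complex" where
  "op_adj M = (\<lambda>x y. cnj (M y x))"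

definition op_trace :: "'x set \<Rightarrow> ('x \<Rightarrow> 'x \<Rightarrow> complex) \<Rightarrow> complex" where
  "op_trace I M = (\<Sum>x\<in>I. M x x)"

definition unitary_op :: "'x set \<Rightarrow> ('x \<Rightarrow> 'x \<Rightarrow> complex) \<Rightarrow> bool" where
  "unitary_op I U \<longleftrightarrow> U \<in> ops I \<and>
     op_comp I (op_adj U) U = op_id I \<and> op_comp I U (op_adj U) = op_id I"

definition psd_op :: "'x set \<Rightarrow> ('x \<Rightarrow> 'x \<Rightarrow> complex) \<Rightarrow> bool" where
  "psd_op I M \<longleftrightarrow> (\<forall>\<psi>\<in>vecs I.
     (\<Sum>x\<in>I. cnj (\<psi> x) * op_apply I M \<psi> x) \<in> \<real> \<and>
     0 \<le> Re (\<Sum>x\<in>I. cnj (\<psi> x) * op_apply I M \<psi> x))"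

definition unit_vec :: "'x set \<Rightarrow> ('x \<Rightarrow> complex) \<Rightarrow> bool" where
  "unit_vec I \<psi> \<longleftrightarrow> \<psi> \<in> vecs I \<and> (\<Sum>x\<in>I. (cmod (\<psi> x))\<^sup>2) = 1"

definition rank_one :: "('x \<Rightarrow> complex) \<Rightarrow> 'x \<Rightarrow> 'x \<Rightarrow> complex" where
  "rank_one \<psi> = (\<lambda>x y. \<psi> x * cnj (\<psi> y))"


section \<open>Quantum channels\<close>

text \<open>
  \<open>tensor_anc \<Phi>\<close> is \<open>\<Phi> \<otimes> id\<close>, where the ancilla basis is indexed by natural numbers; it applies
  \<open>\<Phi>\<close> to every block \<open>\<lambda>a b. M (a, k) (b, l)\<close>.
\<close>

definition tensor_anc ::
  "(('x \<Rightarrow> 'x \<Rightarrow> complex) \<Rightarrow> 'x \<Rightarrow> 'x \<Rightarrow> complex)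
    \<Rightarrow> ('x \<times> nat \<Rightarrow> 'x \<times> nat \<Rightarrow> complex) \<Rightarrow> 'x \<times> nat \<Rightarrow> 'x \<times> nat \<Rightarrow> complex" where
  "tensor_anc \<Phi> M = (\<lambda>(x, k) (y, l). \<Phi> (\<lambda>a b. M (a, k) (b, l)) x y)"

definition linear_supop ::
  "'x set \<Rightarrow> (('x \<Rightarrow> 'x \<Rightarrow> complex) \<Rightarrow> 'x \<Rightarrow> 'x \<Rightarrow> complex) \<Rightarrow> bool" where
  "linear_supop I \<Phi> \<longleftrightarrow> (\<forall>M\<in>ops I. \<Phi> M \<in> ops I) \<and>
     (\<forall>M\<in>ops I. \<forall>N\<in>ops I. \<forall>s t.
        \<Phi> (\<lambda>x y. s * M x y + t * N x y) = (\<lambda>x y. s * \<Phi> M x y + t * \<Phi> N x y))"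

definition completely_positive ::
  "'x set \<Rightarrow> (('x \<Rightarrow> 'x \<Rightarrow> complex) \<Rightarrow> 'x \<Rightarrow> 'x \<Rightarrow> complex) \<Rightarrow> bool" where
  "completely_positive I \<Phi> \<longleftrightarrow> (\<forall>d. \<forall>M\<in>ops (I \<times> {..<d}).
     psd_op (I \<times> {..<d}) M \<longrightarrow> psd_op (I \<times> {..<d}) (tensor_anc \<Phi> M))"

definition quantum_channel ::
  "'x set \<Rightarrow> (('x \<Rightarrow> 'x \<Rightarrow> complex) \<Rightarrow> 'x \<Rightarrow> 'x \<Rightarrow> complex) \<Rightarrow> bool" where
  "quantum_channel I \<Phi> \<longleftrightarrow> linear_supop I \<Phi> \<and> completely_positive I \<Phi> \<and>
     (\<forall>M\<in>ops I. op_trace I (\<Phi> M) = op_trace I M)"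


section \<open>Qudit registers\<close>

text \<open>
  \<open>Sent j\<close> is the transmitted qudit \<open>Q\<^sub>j\<close> and \<open>Bob j\<close> is Bob's noiseless qudit \<open>B\<^sub>j\<close>.  A register
  is a finite set of sites.  Its computational basis, and likewise the vectors of \<open>F\<^sub>q\<^sup>t\<close> indexed by
  its \<open>t\<close> qudits, is the set \<open>labels A\<close> of extensional functions from the register to the field.
\<close>

datatype site = Sent (pos: nat) | Bob (pos: nat)

type_synonym 'f label = "site \<Rightarrow> 'f"
type_synonym 'f ket = "'f label \<Rightarrow> complex"
type_synonym 'f oper = "'f label \<Rightarrow> 'f label \<Rightarrow> complex"

definition labels :: "site set \<Rightarrow> 'f label set" where
  "labels A = (A \<rightarrow>\<^sub>E UNIV)"

definition sent_reg :: "nat \<Rightarrow> site set" where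
  "sent_reg n = Sent ` {1..n}"

definition bob_reg :: "nat \<Rightarrow> site set" where
  "bob_reg c = Bob ` {1..c}"

definition full_reg :: "nat \<Rightarrow> nat \<Rightarrow> site set" where
  "full_reg n c = sent_reg n \<union> bob_reg c"

definition basis_ket :: "'f label \<Rightarrow> 'f ket" where
  "basis_ket x = (\<lambda>y. if y = x then 1 else 0)"

definition ket_tensor :: "site set \<Rightarrow> site set \<Rightarrow> 'f ket \<Rightarrow> 'f ket \<Rightarrow> 'f ket" where
  "ket_tensor A B \<phi> \<chi> =
     (\<lambda>x. if x \<in> labels (A \<union> B) then \<phi> (restrict x A) * \<chi> (restrict x B) else 0)"

text \<open>
  For \<open>A \<subseteq> T\<close>, \<open>tensor_rest A T \<Phi>\<close> is \<open>\<Phi> \<otimes> id\<close> on the register \<open>T\<close>, with \<open>\<Phi>\<close> acting on \<open>A\<close>: it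
  applies \<open>\<Phi>\<close> to the block of \<open>\<rho>\<close> whose coordinates outside \<open>A\<close> are those of \<open>x\<close> and \<open>y\<close>.
\<close>

definition tensor_rest ::
  "site set \<Rightarrow> site set \<Rightarrow> ('f oper \<Rightarrow> 'f oper) \<Rightarrow> 'f oper \<Rightarrow> 'f oper" where
  "tensor_rest A T \<Phi> \<rho> = (\<lambda>x y. if x \<in> labels T \<and> y \<in> labels T
     then \<Phi> (\<lambda>a b. if a \<in> labels A \<and> b \<in> labels A
                   then \<rho> (override_on x a A) (override_on y b A) else 0)
            (restrict x A) (restrict y A)
     else 0)"

text \<open>Both of the following are meant for \<open>E \<subseteq> T\<close> and \<open>\<rho>\<close> an operator on the register \<open>T\<close>.\<close>

definition partial_trace :: "site set \<Rightarrow> site set \<Rightarrow> 'f oper \<Rightarrow> 'f oper" where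
  "partial_trace E T \<rho> = (\<lambda>x y. if x \<in> labels (T - E) \<and> y \<in> labels (T - E)
     then (\<Sum>z\<in>labels E. \<rho> (override_on x z E) (override_on y z E)) else 0)"

text \<open>\<open>erasure E T \<rho>\<close> is \<open>I\<^sub>E / q\<^bsup>|E|\<^esup> \<otimes> Tr\<^sub>E \<rho>\<close>.\<close>

definition erasure :: "site set \<Rightarrow> site set \<Rightarrow> 'f oper \<Rightarrow> 'f oper" where
  "erasure E T \<rho> = (\<lambda>x y. if x \<in> labels T \<and> y \<in> labels T
     then op_id (labels E) (restrict x E) (restrict y E) / of_nat (CARD('f) ^ card E)
            * partial_trace E T \<rho> (restrict x (T - E)) (restrict y (T - E))
     else 0)"


section \<open>Pauli operators\<close>

definition ext_degree :: "'f::finite_field itself \<Rightarrow> nat" where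
  "ext_degree _ = (THE m. CARD('f) = CHAR('f) ^ m)"

text \<open>The trace to the prime field, still as an element of the large field.\<close>

definition field_trace :: "'f::finite_field \<Rightarrow> 'f" where
  "field_trace x = (\<Sum>k<ext_degree TYPE('f). x ^ (CHAR('f) ^ k))"

text \<open>
  The representative in \<open>{0..<p}\<close> of an element of the prime field, needed to use the trace as an
  exponent of \<open>\<omega>\<^sub>p\<close>.
\<close>

definition prime_rep :: "'f::finite_field \<Rightarrow> nat" where
  "prime_rep y = (LEAST k. of_nat k = y)"

definition omega :: "'f::finite_field itself \<Rightarrow> complex" where
  "omega _ = exp (2 * complex_of_real pi * \<i> / of_nat CHAR('f))"

definition qudit_X :: "'f::finite_field \<Rightarrow> 'f \<Rightarrow> 'f \<Rightarrow> complex" where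
  "qudit_X a = (\<lambda>x y. if x = y + a then 1 else 0)"

definition qudit_Z :: "'f::finite_field \<Rightarrow> 'f \<Rightarrow> 'f \<Rightarrow> complex" where
  "qudit_Z b = (\<lambda>x y. if x = y then omega TYPE('f) ^ prime_rep (field_trace (b * y)) else 0)"

definition op_tensor :: "site set \<Rightarrow> (site \<Rightarrow> 'f \<Rightarrow> 'f \<Rightarrow> complex) \<Rightarrow> 'f oper" where
  "op_tensor A M =
     (\<lambda>x y. if x \<in> labels A \<and> y \<in> labels A then \<Prod>j\<in>A. M j (x j) (y j) else 0)"

definition pauli_X :: "site set \<Rightarrow> 'f::finite_field label \<Rightarrow> 'f oper" where
  "pauli_X A a = op_tensor A (\<lambda>j. qudit_X (a j))"

definition pauli_Z :: "site set \<Rightarrow> 'f::finite_field label \<Rightarrow> 'f oper" where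
  "pauli_Z A b = op_tensor A (\<lambda>j. qudit_Z (b j))"

definition pauli :: "site set \<Rightarrow> nat \<Rightarrow> 'f::finite_field label \<Rightarrow> 'f label \<Rightarrow> 'f oper" where
  "pauli A l a b =
     (\<lambda>x y. omega TYPE('f) ^ l * op_comp (labels A) (pauli_X A a) (pauli_Z A b) x y)"

definition pauli_group :: "site set \<Rightarrow> 'f::finite_field oper monoid" where
  "pauli_group A =
     \<lparr> carrier = {pauli A l a b | l a b. l < CHAR('f) \<and> a \<in> labels A \<and> b \<in> labels A},
       mult = op_comp (labels A),
       one = op_id (labels A) \<rparr>"

text \<open>
  The label of \<open>\<omega>\<^sub>p\<^sup>l X\<^sub>A(a) Z\<^sub>A(b)\<close> is \<open>(a, b)\<close>.  On \<open>full_reg n c\<close> the first component contains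
  both the \<open>X\<close>-part on the transmitted qudits (at \<open>Sent j\<close>) and that on Bob's qudits (at \<open>Bob j\<close>),
  and similarly for the second.
\<close>

definition pauli_label :: "site set \<Rightarrow> 'f::finite_field oper \<Rightarrow> 'f label \<times> 'f label" where
  "pauli_label A G = (THE (a, b). a \<in> labels A \<and> b \<in> labels A \<and>
     (\<exists>l<CHAR('f). G = pauli A l a b))"

definition supp_Q :: "nat \<Rightarrow> nat \<Rightarrow> 'f::finite_field oper \<Rightarrow> nat set" where
  "supp_Q n c G = (case pauli_label (full_reg n c) G of
     (a, b) \<Rightarrow> {j\<in>{1..n}. (a (Sent j), b (Sent j)) \<noteq> (0, 0)})"

definition Fq_linear :: "site set \<Rightarrow> ('f::finite_field label \<times> 'f label) set \<Rightarrow> bool" where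
  "Fq_linear A L \<longleftrightarrow> L \<subseteq> labels A \<times> labels A \<and>
     ((\<lambda>j\<in>A. 0), (\<lambda>j\<in>A. 0)) \<in> L \<and>
     (\<forall>(a, b)\<in>L. \<forall>(a', b')\<in>L. ((\<lambda>j\<in>A. a j + a' j), (\<lambda>j\<in>A. b j + b' j)) \<in> L) \<and>
     (\<forall>s. \<forall>(a, b)\<in>L. ((\<lambda>j\<in>A. s * a j), (\<lambda>j\<in>A. s * b j)) \<in> L)"


section \<open>Entanglement-assisted codes\<close>

text \<open>
  The encoder input puts the \<open>k\<close> logical qudits at the sites \<open>1..k\<close>, the ancillas \<open>|0\<rangle>\<close> at
  \<open>k+1..n-c\<close> and the halves of the maximally entangled pairs at \<open>n-c+1..n\<close>.  For unitary \<open>U\<close> and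
  \<open>k + c \<le> n\<close> the resulting encoder is automatically an isometry.
\<close>

definition ea_encoder ::
  "nat \<Rightarrow> nat \<Rightarrow> nat \<Rightarrow> 'f::finite_field oper \<Rightarrow> 'f ket \<Rightarrow> 'f ket" where
  "ea_encoder n k c U \<phi> =
     (let L = Sent ` {1..k}; Z = Sent ` {k + 1..n - c}; E = Sent ` {n - c + 1..n} in
      (\<lambda>y. complex_of_real (real CARD('f) powr (- real c / 2)) *
        (\<Sum>x\<in>({1..c} \<rightarrow>\<^sub>E (UNIV :: 'f set)).
           ket_tensor (sent_reg n) (bob_reg c)
             (op_apply (labels (sent_reg n)) U
               (ket_tensor L (Z \<union> E) \<phi>
                 (ket_tensor Z E
                   (basis_ket (\<lambda>s\<in>Z. 0))
                   (basis_ket (\<lambda>s\<in>E. x (pos s - (n - c)))))))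
             (basis_ket (\<lambda>s\<in>bob_reg c. x (pos s)))
           y)))"

definition corrects_erasures :: "nat \<Rightarrow> nat \<Rightarrow> 'f::finite_field ket set \<Rightarrow> nat set \<Rightarrow> bool" where
  "corrects_erasures n c C E \<longleftrightarrow> (\<exists>\<Phi>. quantum_channel (labels (full_reg n c)) \<Phi> \<and>
     (\<forall>\<psi>\<in>C. unit_vec (labels (full_reg n c)) \<psi> \<longrightarrow>
        \<Phi> (erasure (Sent ` E) (full_reg n c) (rank_one \<psi>)) = rank_one \<psi>))"

definition EAQECC ::
  "nat \<Rightarrow> nat \<Rightarrow> nat \<Rightarrow> nat \<Rightarrow> 'f::finite_field ket set \<Rightarrow> bool" where
  "EAQECC n k \<delta> c C \<longleftrightarrow> k + c \<le> n \<and>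
     (\<exists>U. unitary_op (labels (sent_reg n)) U \<and>
          C = ea_encoder n k c U ` vecs (labels (Sent ` {1..k}))) \<and>
     (\<forall>E\<subseteq>{1..n}. card E < \<delta> \<longrightarrow> corrects_erasures n c C E)"

definition EASC ::
  "nat \<Rightarrow> nat \<Rightarrow> nat \<Rightarrow> nat \<Rightarrow> 'f::finite_field oper set \<Rightarrow> 'f ket set \<Rightarrow> bool" where
  "EASC n k \<delta> c S C \<longleftrightarrow> EAQECC n k \<delta> c C \<and>
     subgroup S (pauli_group (full_reg n c)) \<and>
     (\<forall>G\<in>S. \<forall>K\<in>S. op_comp (labels (full_reg n c)) G K = op_comp (labels (full_reg n c)) K G) \<and>
     C = {\<psi>\<in>vecs (labels (full_reg n c)). \<forall>G\<in>S. op_apply (labels (full_reg n c)) G \<psi> = \<psi>}"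

definition recovery_set ::
  "nat \<Rightarrow> nat \<Rightarrow> 'f::finite_field ket set \<Rightarrow> nat \<Rightarrow> nat set \<Rightarrow> bool" where
  "recovery_set n c C i R \<longleftrightarrow> R \<subseteq> {1..n} - {i} \<and>
     (\<exists>Rec. quantum_channel (labels (Sent ` ({i} \<union> R) \<union> bob_reg c)) Rec \<and>
       (\<forall>\<psi>\<in>C. unit_vec (labels (full_reg n c)) \<psi> \<longrightarrow>
          tensor_rest (Sent ` ({i} \<union> R) \<union> bob_reg c) (full_reg n c) Rec
            (erasure {Sent i} (full_reg n c) (rank_one \<psi>)) = rank_one \<psi>))"

definition EAQLRC ::
  "nat \<Rightarrow> nat \<Rightarrow> nat \<Rightarrow> nat \<Rightarrow> int \<Rightarrow> 'f::finite_field ket set \<Rightarrow> bool" where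
  "EAQLRC n k \<delta> c r C \<longleftrightarrow> EAQECC n k \<delta> c C \<and>
     (\<forall>i\<in>{1..n}. \<exists>R. recovery_set n c C i R \<and> int (card R) \<le> r)"

end

theory Submission
  imports Defs "HOL-Number_Theory.Residues" "HOL-Computational_Algebra.Polynomial"
begin

text \<open>
  By linearity the labels of \<open>G\<^sub>i\<close> and \<open>K\<^sub>i\<close> span \<open>q\<^sup>2\<close> labels, each carried by some stabilizer
  \<open>P\<^sub>s\<close>, \<open>s = (\<alpha>, \<beta>)\<close>, which acts on qudit \<open>i\<close> as \<open>X(\<alpha>) Z(\<beta>)\<close> and trivially outside
  \<open>Q\<^sub>i\<close>, \<open>R\<close> and Bob's register.  Put \<open>\<Pi> = q\<^sup>-\<^sup>2 \<Sum>\<^sub>s P\<^sub>s\<close>.  Recovery has the Kraus operators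
  \<open>\<surd>q \<Pi> (|u\<rangle>\<langle>v|\<^sub>i \<otimes> I)\<close>.  It preserves the trace because for \<open>s \<noteq> t\<close> the operator \<open>P\<^sub>s\<^sup>\<dagger> P\<^sub>t\<close> is a
  nontrivial Pauli at \<open>i\<close> and so has vanishing partial trace over \<open>Q\<^sub>i\<close>.  It undoes the erasure
  because \<open>\<Pi> (|u\<rangle>\<langle>w|\<^sub>i \<otimes> I) \<phi> = \<delta>\<^bsub>uw\<^esub> \<phi> / q\<close> whenever every \<open>P\<^sub>s\<close> fixes \<open>\<phi>\<close>.  The \<open>P\<^sub>s\<close>
  need not form a group, so for each label any stabilizer carrying it will do.
\<close>

section \<open>The additive character of a finite field\<close>

text \<open>The canonical additive character of the field; the diagonal entries of
  \<open>qudit_Z b\<close> are its values at \<open>b * y\<close>.\<close>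

definition add_char :: "'f::finite_field \<Rightarrow> complex" where
  "add_char x = omega TYPE('f) ^ prime_rep (field_trace x)"

lemma prime_CHAR_finite_field: "prime CHAR('f::finite_field)"
  by (rule prime_CHAR_semidom) (simp add: finite_imp_CHAR_pos)

text \<open>Connects the prime p of the theorem with \<open>CHAR('f)\<close>, on which the Pauli
  operators are built: the characteristic is a prime dividing the order of the field.\<close>

lemma CHAR_eq_if_CARD_prime_power:
  assumes "prime p" "CARD('f::finite_field) = p ^ m"
  shows "CHAR('f) = p"
proof -
  have "CHAR('f) dvd p ^ m"
    using CHAR_dvd_CARD[where 'a = 'f] assms(2) by simp
  then have "CHAR('f) dvd p"
    using prime_CHAR_finite_field prime_dvd_power by blast
  then show ?thesis
    using assms(1) prime_CHAR_finite_field[where 'f = 'f] by (simp add: primes_dvd_imp_eq)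
qed

section \<open>Powers of the root of unity\<close>

lemma cmod_omega [simp]: "cmod (omega TYPE('f::finite_field)) = 1"
proof -
  have "omega TYPE('f) = cis (2 * pi / real CHAR('f))"
    by (simp add: omega_def cis_conv_exp mult_ac)
  then show ?thesis by simp
qed

lemma omega_power_CHAR: "omega TYPE('f::finite_field) ^ CHAR('f) = 1"
proof -
  have "CHAR('f) \<noteq> 0"
    using prime_CHAR_finite_field[where 'f = 'f] by auto
  then have "omega TYPE('f) ^ CHAR('f) = exp (2 * of_real pi * \<i>)"
    by (simp add: omega_def flip: exp_of_nat_mult)
  then show ?thesis by (simp add: exp_two_pi_i)
qed

lemma omega_power_cong:
  assumes "[j = k] (mod CHAR('f::finite_field))"
  shows "omega TYPE('f) ^ j = omega TYPE('f) ^ k"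
proof -
  have "omega TYPE('f) ^ l = omega TYPE('f) ^ (l mod CHAR('f))" for l
  proof -
    have "omega TYPE('f) ^ l = omega TYPE('f) ^ (CHAR('f) * (l div CHAR('f)) + l mod CHAR('f))"
      by simp
    also have "\<dots> = omega TYPE('f) ^ (l mod CHAR('f))"
      by (simp only: power_add power_mult omega_power_CHAR power_one mult_1)
    finally show ?thesis .
  qed
  then show ?thesis using assms by (metis cong_def)
qed

text \<open>The numbers cis (2 pi j / p) with j < p are pairwise distinct, and j = 0 already gives
  1.\<close>

lemma omega_power_neq_1:
  assumes "0 < k" "k < CHAR('f::finite_field)"
  shows "omega TYPE('f) ^ k \<noteq> 1"
proof
  assume "omega TYPE('f) ^ k = 1"
  moreover have "omega TYPE('f) ^ k = cis (2 * pi * real k / real CHAR('f))"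
    by (simp add: omega_def cis_conv_exp mult_ac flip: exp_of_nat_mult)
  ultimately have "cis (2 * pi * real k / real CHAR('f)) = cis (2 * pi * real 0 / real CHAR('f))"
    by simp
  moreover have "inj_on (\<lambda>j. cis (2 * pi * real j / real CHAR('f))) {..<CHAR('f)}"
    using bij_betw_roots_unity[of "CHAR('f)"] assms by (auto simp: bij_betw_def)
  ultimately show False
    using assms inj_onD[of "\<lambda>j. cis (2 * pi * real j / real CHAR('f))" "{..<CHAR('f)}" k 0]
    by auto
qed

text \<open>X^p - X has at most p roots. By Fermat's little theorem the images of 0, ..., p - 1 are
  p distinct ones, so there are no others.\<close>

lemma prime_field_elemI:
  fixes y :: "'f::finite_field"
  assumes "y ^ CHAR('f) = y"
  shows "\<exists>k<CHAR('f). of_nat k = y"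
proof -
  let ?p = "CHAR('f)"
  define P :: "'f poly" where "P = monom 1 ?p - monom 1 1"
  have p1: "?p > 1"
    using prime_CHAR_finite_field prime_gt_1_nat by blast
  have "coeff P ?p = 1"
    using p1 by (simp add: P_def)
  then have nz: "P \<noteq> 0" by auto
  have "degree P \<le> ?p"
    unfolding P_def by (rule degree_diff_le) (use p1 in \<open>auto simp: degree_monom_eq\<close>)
  then have card: "card {x. poly P x = 0} \<le> ?p"
    using card_poly_roots_bound[OF nz] by linarith
  have inj: "inj_on (of_nat :: nat \<Rightarrow> 'f) {..<?p}"
    by (rule inj_onI) (auto simp: of_nat_eq_iff_cong_CHAR cong_def)
  have fermat: "of_nat k ^ ?p = (of_nat k :: 'f)" for k
    by (induction k) (use p1 in \<open>auto simp: freshmans_dream[OF prime_CHAR_finite_field]\<close>)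
  have sub: "of_nat ` {..<?p} \<subseteq> {x. poly P x = 0}"
    by (auto simp: P_def poly_monom fermat)
  have "of_nat ` {..<?p} = {x. poly P x = 0}"
    by (rule card_subset_eq) (use sub card inj card_mono[OF _ sub] in \<open>auto simp: card_image\<close>)
  moreover have "poly P y = 0"
    using assms by (simp add: P_def poly_monom)
  ultimately show ?thesis
    by (metis (mono_tags, lifting) imageE lessThan_iff mem_Collect_eq)
qed

section \<open>Trace and additive character of a field with p^m elements\<close>

locale finite_field_degree =
  fixes F :: "'f::finite_field itself" and m :: nat
  assumes card_field: "CARD('f) = CHAR('f) ^ m"
begin

lemma degree_pos: "0 < m"
proof (rule ccontr)
  assume "\<not> 0 < m"
  then have "CARD('f) = 1" using card_field by simp
  then obtain x where "UNIV = {x :: 'f}" by (auto simp: card_1_singleton_iff)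
  then show False by (metis UNIV_I singletonD zero_neq_one)
qed

lemma ext_degree_eq: "ext_degree TYPE('f) = m"
  unfolding ext_degree_def
proof (rule the_equality)
  show "CARD('f) = CHAR('f) ^ m" by (fact card_field)
  have "CHAR('f) > 1"
    using prime_CHAR_finite_field prime_gt_1_nat by blast
  then show "k = m" if "CARD('f) = CHAR('f) ^ k" for k
    using that card_field power_inject_exp by metis
qed

lemma field_trace_eq: "field_trace (x :: 'f) = (\<Sum>k<m. x ^ (CHAR('f) ^ k))"
  by (simp add: field_trace_def ext_degree_eq)

lemma field_trace_add: "field_trace (x + y :: 'f) = field_trace x + field_trace y"
  by (simp add: field_trace_eq freshmans_dream'[OF prime_CHAR_finite_field refl] sum.distrib)

text \<open>Frobenius turns each summand into the next one and the last into x^q = x, so it only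
  permutes the summands cyclically.\<close>

lemma field_trace_power_CHAR: "field_trace (x :: 'f) ^ CHAR('f) = field_trace x"
proof -
  obtain l where m: "m = Suc l"
    using degree_pos gr0_implies_Suc by blast
  have "field_trace x ^ CHAR('f) = (\<Sum>k<m. x ^ (CHAR('f) ^ Suc k))"
    by (simp add: field_trace_eq freshmans_dream_sum[OF prime_CHAR_finite_field refl] mult.commute
        flip: power_mult)
  also have "\<dots> = (\<Sum>k<l. x ^ (CHAR('f) ^ Suc k)) + x ^ CARD('f)"
    by (simp add: card_field m)
  also have "\<dots> = (\<Sum>k<m. x ^ (CHAR('f) ^ k))"
    by (simp only: finite_field_power_card_eq_same m sum.lessThan_Suc_shift[of _ l]) simp
  finally show ?thesis by (simp add: field_trace_eq)
qed

text \<open>A trace is fixed by Frobenius, hence lies in the prime field, so the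
  \<open>LEAST\<close> in \<open>prime_rep\<close> ranges over a nonempty set.\<close>

lemma prime_rep_field_trace:
  shows "of_nat (prime_rep (field_trace x)) = field_trace (x :: 'f)"
    and "prime_rep (field_trace x) < CHAR('f)"
proof -
  obtain k where k: "k < CHAR('f)" "of_nat k = field_trace x"
    using prime_field_elemI[OF field_trace_power_CHAR] by blast
  show "of_nat (prime_rep (field_trace x)) = field_trace x"
    unfolding prime_rep_def by (rule LeastI) (rule k(2))
  have "prime_rep (field_trace x) \<le> k"
    unfolding prime_rep_def by (rule Least_le) (rule k(2))
  then show "prime_rep (field_trace x) < CHAR('f)"
    using k(1) by simp
qed

text \<open>The representatives of traces add up only modulo p, which suffices in an exponent of
  \<open>omega\<close>.\<close>

lemma add_char_add: "add_char (x + y :: 'f) = add_char x * add_char y"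
proof -
  have "of_nat (prime_rep (field_trace (x + y))) =
      (of_nat (prime_rep (field_trace x) + prime_rep (field_trace y)) :: 'f)"
    unfolding of_nat_add prime_rep_field_trace(1) by (rule field_trace_add)
  then show ?thesis
    unfolding add_char_def power_add[symmetric]
    by (intro omega_power_cong) (simp only: of_nat_eq_iff_cong_CHAR)
qed

lemma cmod_add_char [simp]: "cmod (add_char (x :: 'f)) = 1"
  by (simp add: add_char_def norm_power)

lemma add_char_0 [simp]: "add_char (0 :: 'f) = 1"
  using add_char_add[of 0 0] cmod_add_char[of 0] by (metis add.right_neutral mult_cancel_left2 norm_zero zero_neq_one)

lemma cnj_add_char: "cnj (add_char (x :: 'f)) = add_char (- x)"
proof -
  have "add_char x * add_char (- x) = 1"
    by (simp flip: add_char_add)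
  moreover have "add_char x * cnj (add_char x) = 1"
    by (simp flip: complex_norm_square)
  ultimately show ?thesis
    by (metis mult_cancel_left mult_zero_left zero_neq_one)
qed

lemma add_char_diff: "add_char (x - y :: 'f) = add_char x * cnj (add_char y)"
  using add_char_add[of x "- y"] by (simp add: cnj_add_char)

text \<open>The trace is a nonzero polynomial of degree at most p^(m-1) < q, so not all q elements
  are roots.\<close>

lemma field_trace_nonzero: "\<exists>x :: 'f. field_trace x \<noteq> 0"
proof (rule ccontr)
  assume "\<not> ?thesis"
  then have zero: "field_trace x = 0" for x :: 'f by blast
  define P :: "'f poly" where "P = (\<Sum>k<m. monom 1 (CHAR('f) ^ k))"
  have p1: "CHAR('f) > 1"
    using prime_CHAR_finite_field prime_gt_1_nat by blast
  obtain l where m: "m = Suc l"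
    using degree_pos gr0_implies_Suc by blast
  have "coeff P (CHAR('f) ^ l) = (\<Sum>k<m. if k = l then 1 else 0)"
    unfolding P_def coeff_sum by (rule sum.cong) (use p1 in auto)
  then have nz: "P \<noteq> 0" using m by auto
  have "degree P \<le> CHAR('f) ^ l"
    unfolding P_def
  proof (rule degree_sum_le)
    fix k assume "k \<in> {..<m}"
    then have "CHAR('f) ^ k \<le> CHAR('f) ^ l"
      using p1 m by (intro power_increasing) auto
    then show "degree (monom 1 (CHAR('f) ^ k) :: 'f poly) \<le> CHAR('f) ^ l"
      using degree_monom_le order_trans by blast
  qed simp
  also have "\<dots> < CARD('f)"
    using p1 by (simp add: card_field m)
  finally have "card {x. poly P x = 0} < CARD('f)"
    using card_poly_roots_bound[OF nz] by linarith
  moreover have "{x. poly P x = 0} = UNIV"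
    using zero by (auto simp: P_def poly_sum poly_monom field_trace_eq)
  ultimately show False by simp
qed

lemma add_char_nontrivial: "\<exists>x :: 'f. add_char x \<noteq> 1"
proof -
  obtain x :: 'f where "field_trace x \<noteq> 0"
    using field_trace_nonzero by blast
  then have "prime_rep (field_trace x) \<noteq> 0"
    using prime_rep_field_trace(1)[of x] by (metis of_nat_0)
  then have "add_char x \<noteq> 1"
    unfolding add_char_def by (intro omega_power_neq_1) (auto simp: prime_rep_field_trace)
  then show ?thesis ..
qed

lemma add_char_separates:
  assumes "\<And>z :: 'f. add_char (b * z) = add_char (b' * z)"
  shows "b = b'"
proof (rule ccontr)
  assume ne: "b \<noteq> b'"
  obtain x :: 'f where x: "add_char x \<noteq> 1"
    using add_char_nontrivial by blast
  define z where "z = x / (b - b')"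
  have "add_char (b * z) = add_char (b' * z) * add_char ((b - b') * z)"
    by (simp add: algebra_simps flip: add_char_add)
  moreover have "add_char (b' * z) \<noteq> 0"
    using cmod_add_char[of "b' * z"] by force
  ultimately have "add_char ((b - b') * z) = 1"
    using assms[of z] by simp
  then show False using x ne by (simp add: z_def)
qed

text \<open>For nonzero b, translating the summation variable by x multiplies the sum by
  \<open>add_char (b * x)\<close>, and some x makes this factor different from 1.\<close>

lemma sum_add_char: "(\<Sum>z\<in>UNIV. add_char (b * z :: 'f)) = (if b = 0 then of_nat CARD('f) else 0)"
proof (cases "b = 0")
  case False
  obtain x :: 'f where x: "add_char (b * x) \<noteq> 1"
    using add_char_separates[of b 0] False by auto
  have "(\<Sum>z\<in>UNIV. add_char (b * z)) = (\<Sum>z\<in>UNIV. add_char (b * (x + z)))"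
    by (rule sum.reindex_bij_witness[of _ "\<lambda>z. x + z" "\<lambda>z. z - x"]) auto
  also have "\<dots> = add_char (b * x) * (\<Sum>z\<in>UNIV. add_char (b * z))"
    by (simp add: distrib_left add_char_add sum_distrib_left)
  finally show ?thesis using x False by auto
qed simp

end

section \<open>Kraus maps\<close>

definition kraus_map ::
  "'x set \<Rightarrow> 'k set \<Rightarrow> ('k \<Rightarrow> 'x \<Rightarrow> 'x \<Rightarrow> complex) \<Rightarrow> ('x \<Rightarrow> 'x \<Rightarrow> complex) \<Rightarrow> 'x \<Rightarrow> 'x \<Rightarrow> complex" where
  "kraus_map D N K M = (\<lambda>x y. \<Sum>k\<in>N. \<Sum>u\<in>D. \<Sum>v\<in>D. K k x u * M u v * cnj (K k y v))"

lemma linear_kraus_map: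
  assumes "\<And>k. k \<in> N \<Longrightarrow> K k \<in> ops D"
  shows "linear_supop D (kraus_map D N K)"
  unfolding linear_supop_def
proof (intro conjI ballI allI)
  fix M assume "M \<in> ops D"
  show "kraus_map D N K M \<in> ops D"
    using assms by (auto simp: ops_def kraus_map_def intro!: sum.neutral)
next
  fix M M' s t
  show "kraus_map D N K (\<lambda>x y. s * M x y + t * M' x y) =
      (\<lambda>x y. s * kraus_map D N K M x y + t * kraus_map D N K M' x y)"
    by (simp add: kraus_map_def sum_distrib_left sum.distrib algebra_simps)
qed

text \<open>Cyclicity of the trace, entrywise: after the sums are reordered, M is paired with the
  sum of the products \<open>K k\<close>-adjoint times \<open>K k\<close>.\<close>

lemma trace_kraus_map:
  assumes fin: "finite D"
    and complete: "\<And>x y. (\<Sum>k\<in>N. op_comp D (op_adj (K k)) (K k) x y) = op_id D x y"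
  shows "op_trace D (kraus_map D N K M) = op_trace D M"
proof -
  have "op_trace D (kraus_map D N K M)
      = (\<Sum>x\<in>D. \<Sum>k\<in>N. \<Sum>u\<in>D. \<Sum>v\<in>D. K k x u * M u v * cnj (K k x v))"
    by (simp add: op_trace_def kraus_map_def)
  also have "\<dots> = (\<Sum>k\<in>N. \<Sum>x\<in>D. \<Sum>u\<in>D. \<Sum>v\<in>D. K k x u * M u v * cnj (K k x v))"
    by (rule sum.swap)
  also have "\<dots> = (\<Sum>k\<in>N. \<Sum>u\<in>D. \<Sum>v\<in>D. \<Sum>x\<in>D. K k x u * M u v * cnj (K k x v))"
    by (rule sum.cong[OF refl], rule trans[OF sum.swap], rule sum.cong[OF refl], rule sum.swap)
  also have "\<dots> = (\<Sum>u\<in>D. \<Sum>v\<in>D. \<Sum>k\<in>N. \<Sum>x\<in>D. K k x u * M u v * cnj (K k x v))"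
    by (rule trans[OF sum.swap]) (intro sum.cong refl, rule sum.swap)
  also have "\<dots> = (\<Sum>u\<in>D. \<Sum>v\<in>D. M u v * (\<Sum>k\<in>N. op_comp D (op_adj (K k)) (K k) v u))"
    by (simp add: op_comp_def op_adj_def sum_distrib_left mult_ac)
  also have "\<dots> = (\<Sum>u\<in>D. \<Sum>v\<in>D. if v = u then M u v else 0)"
    unfolding complete by (intro sum.cong) (auto simp: op_id_def)
  also have "\<dots> = op_trace D M"
    using fin by (simp add: op_trace_def sum.delta)
  finally show ?thesis .
qed

text \<open>The quadratic form of the output at \<psi> is a sum over k of quadratic forms of
  \<open>M\<close>, each nonnegative by assumption.\<close>

lemma completely_positive_kraus_map: "completely_positive D (kraus_map D N K)"
  unfolding completely_positive_def
proof (intro allI ballI impI)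
  fix d and M :: "'a \<times> nat \<Rightarrow> 'a \<times> nat \<Rightarrow> complex"
  assume psd: "psd_op (D \<times> {..<d}) M"
  let ?I = "D \<times> {..<d}"
  show "psd_op ?I (tensor_anc (kraus_map D N K) M)"
    unfolding psd_op_def
  proof
    fix \<psi> assume "\<psi> \<in> vecs ?I"
    \<comment> \<open>The adjoint of \<open>K k\<close>, tensored with the identity on the ancilla,
      applied to \<psi>.\<close>
    define \<eta> where "\<eta> k = (\<lambda>z. if z \<in> ?I then \<Sum>y\<in>D. cnj (K k y (fst z)) * \<psi> (y, snd z) else 0)" for k
    have \<eta>: "\<eta> k \<in> vecs ?I" for k
      by (simp add: \<eta>_def vecs_def)
    let ?f = "\<lambda>k x j y l u v. cnj (\<psi> (x, j)) * (K k x u * M (u, j) (v, l) * cnj (K k y v) * \<psi> (y, l))"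
    have "(\<Sum>z\<in>?I. cnj (\<psi> z) * op_apply ?I (tensor_anc (kraus_map D N K) M) \<psi> z)
        = (\<Sum>x\<in>D. \<Sum>j<d. \<Sum>y\<in>D. \<Sum>l<d. \<Sum>k\<in>N. \<Sum>u\<in>D. \<Sum>v\<in>D. ?f k x j y l u v)"
      by (simp add: op_apply_def tensor_anc_def kraus_map_def sum.cartesian_product' sum_distrib_left
          sum_distrib_right)
    also have "\<dots> = (\<Sum>k\<in>N. \<Sum>u\<in>D. \<Sum>j<d. \<Sum>v\<in>D. \<Sum>l<d. \<Sum>y\<in>D. \<Sum>x\<in>D. ?f k x j y l u v)"
    proof -
      have "(\<Sum>x\<in>D. \<Sum>j<d. \<Sum>y\<in>D. \<Sum>l<d. \<Sum>k\<in>N. \<Sum>u\<in>D. \<Sum>v\<in>D. ?f k x j y l u v)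
          = (\<Sum>(x, j, y, l, k, u, v)\<in>D \<times> {..<d} \<times> D \<times> {..<d} \<times> N \<times> D \<times> D. ?f k x j y l u v)"
        by (simp add: sum.cartesian_product')
      also have "\<dots> = (\<Sum>(k, u, j, v, l, y, x)\<in>N \<times> D \<times> {..<d} \<times> D \<times> {..<d} \<times> D \<times> D. ?f k x j y l u v)"
        by (rule sum.reindex_bij_witness[of _ "\<lambda>(k, u, j, v, l, y, x). (x, j, y, l, k, u, v)"
              "\<lambda>(x, j, y, l, k, u, v). (k, u, j, v, l, y, x)"]) auto
      finally show ?thesis by (simp add: sum.cartesian_product')
    qed
    also have "\<dots> = (\<Sum>k\<in>N. \<Sum>z\<in>?I. cnj (\<eta> k z) * op_apply ?I M (\<eta> k) z)"
      by (simp add: op_apply_def \<eta>_def sum.cartesian_product' sum_distrib_left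
          sum_distrib_right mult_ac)
    finally have eq: "(\<Sum>z\<in>?I. cnj (\<psi> z) * op_apply ?I (tensor_anc (kraus_map D N K) M) \<psi> z)
        = (\<Sum>k\<in>N. \<Sum>z\<in>?I. cnj (\<eta> k z) * op_apply ?I M (\<eta> k) z)" .
    show "(\<Sum>z\<in>?I. cnj (\<psi> z) * op_apply ?I (tensor_anc (kraus_map D N K) M) \<psi> z) \<in> \<real> \<and>
        0 \<le> Re (\<Sum>z\<in>?I. cnj (\<psi> z) * op_apply ?I (tensor_anc (kraus_map D N K) M) \<psi> z)"
      unfolding eq Re_sum[of _ N] using psd \<eta>
      by (intro conjI sum_in_Reals[of N] sum_nonneg[of N]) (simp_all only: psd_op_def)
  qed
qed

lemma quantum_channel_kraus_map:
  assumes "finite D" "\<And>k. k \<in> N \<Longrightarrow> K k \<in> ops D"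
    and "\<And>x y. (\<Sum>k\<in>N. op_comp D (op_adj (K k)) (K k) x y) = op_id D x y"
  shows "quantum_channel D (kraus_map D N K)"
  unfolding quantum_channel_def
  using linear_kraus_map[of N K D] completely_positive_kraus_map[of D N K] trace_kraus_map[of D K N] assms by blast

section \<open>Pauli operators\<close>

lemma finite_labels [simp]: "finite A \<Longrightarrow> finite (labels A :: 'f::finite label set)"
  unfolding labels_def by (rule finite_PiE) auto

lemma labels_upd: "x \<in> labels A \<Longrightarrow> i \<in> A \<Longrightarrow> x(i := w) \<in> labels A"
  by (auto simp: labels_def PiE_def extensional_def)

lemma restrict_labels [simp]: "restrict x A \<in> labels A"
  by (simp add: labels_def)

lemma labels_eqI: "x \<in> labels A \<Longrightarrow> y \<in> labels A \<Longrightarrow> (\<And>j. j \<in> A \<Longrightarrow> x j = y j) \<Longrightarrow> x = y"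
  unfolding labels_def by (rule PiE_ext)

text \<open>As coordinate i is overwritten in the summand, v only selects labels; setting that
  coordinate to u maps the labels reading v at i bijectively to those reading u.\<close>

lemma sum_labels_coord:
  assumes "i \<in> A"
  shows "(\<Sum>x \<in> labels A. if x i = v then h (x(i := u)) (x(i := w)) else 0)
       = (\<Sum>x \<in> labels A. if x i = u then h x (x(i := w)) else (0::complex))"
proof (cases "finite (labels A :: (site \<Rightarrow> 'a) set)")
  case True
  have "(\<Sum>x \<in> {x \<in> labels A. x i = v}. h (x(i := u)) (x(i := w)))
      = (\<Sum>x \<in> {x \<in> labels A. x i = u}. h x (x(i := w)))"
    by (rule sum.reindex_bij_witness[of _ "\<lambda>x. x(i := v)" "\<lambda>x. x(i := u)"])
      (use assms in \<open>auto simp: labels_upd\<close>)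
  then show ?thesis
    using True by (simp add: sum.inter_filter)
\<comment> \<open>Over an infinite label set both sums are 0 by convention.\<close>
qed simp

text \<open>Tensor products of monomial matrices are monomial. Taking \<open>f\<close> as a shift
  covers the X operators, as the identity the Z operators.\<close>

lemma op_tensor_monomial:
  fixes x y :: "'f::zero_neq_one label"
  assumes "finite A"
  shows "op_tensor A (\<lambda>j u v. if u = f j v then c j v else 0) x y =
    (if x \<in> labels A \<and> y \<in> labels A \<and> (\<forall>j\<in>A. x j = f j (y j)) then \<Prod>j\<in>A. c j (y j) else 0)"
proof (cases "\<forall>j\<in>A. x j = f j (y j)")
  case True
  then show ?thesis by (simp add: op_tensor_def)
next
  case False
  then have "(\<Prod>j\<in>A. if x j = f j (y j) then c j (y j) else 0) = 0"
    using assms by (intro prod_zero) auto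
  then show ?thesis using False by (auto simp: op_tensor_def)
qed

text \<open>The Z part is diagonal, so one term of the matrix product survives. It acts first, hence
  the phase is read off the column label y.\<close>

lemma pauli_entry:
  fixes a b x y :: "'f::finite_field label"
  assumes fin: "finite A"
  shows "pauli A l a b x y =
    (if x \<in> labels A \<and> y \<in> labels A \<and> (\<forall>j\<in>A. x j = y j + a j)
     then omega TYPE('f) ^ l * (\<Prod>j\<in>A. add_char (b j * y j)) else 0)"
proof -
  have X: "pauli_X A a x z = (if x \<in> labels A \<and> z \<in> labels A \<and> (\<forall>j\<in>A. x j = z j + a j) then 1 else 0)"
    for z
    using op_tensor_monomial[OF fin, of "\<lambda>j v. v + a j" "\<lambda>_ _. 1" x z]
    by (simp add: pauli_X_def qudit_X_def)
  have Z: "pauli_Z A b z y = (if z = y \<and> y \<in> labels A then \<Prod>j\<in>A. add_char (b j * y j) else 0)" for z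
    using op_tensor_monomial[OF fin, of "\<lambda>j v. v" "\<lambda>j v. add_char (b j * v)" z y]
    unfolding pauli_Z_def qudit_Z_def add_char_def[symmetric] by (auto intro: labels_eqI)
  have "op_comp (labels A) (pauli_X A a) (pauli_Z A b) x y
      = (\<Sum>z\<in>labels A. if z = y then pauli_X A a x y * pauli_Z A b y y else 0)"
    unfolding op_comp_def by (rule sum.cong) (auto simp: Z)
  also have "\<dots> = pauli_X A a x y * pauli_Z A b y y"
    using fin by (auto simp: sum.delta' Z)
  finally show ?thesis
    by (simp add: pauli_def X Z)
qed

lemma op_apply_pauli:
  fixes a b x :: "'f::finite_field label"
  assumes fin: "finite A" and x: "x \<in> labels A"
  shows "op_apply (labels A) (pauli A l a b) g x =
    omega TYPE('f) ^ l * (\<Prod>j\<in>A. add_char (b j * (x j - a j))) * g (\<lambda>j\<in>A. x j - a j)"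
proof -
  let ?x' = "\<lambda>j\<in>A. x j - a j"
  have "(\<forall>j\<in>A. x j = y j + a j) \<longleftrightarrow> y = ?x'" if "y \<in> labels A" for y
    using that by (auto intro!: labels_eqI[of y])
  then have "op_apply (labels A) (pauli A l a b) g x
      = (\<Sum>y\<in>labels A. if y = ?x' then pauli A l a b x ?x' * g ?x' else 0)"
    unfolding op_apply_def by (intro sum.cong) (auto simp: pauli_entry[OF fin])
  also have "\<dots> = pauli A l a b x ?x' * g ?x'"
    using fin by simp
  finally show ?thesis
    using x by (simp add: pauli_entry[OF fin] cong: prod.cong_simp)
qed

context finite_field_degree
begin

text \<open>The (x, y) entry of the adjoint of one Pauli times another. Columns x and y have their
  only nonzero entries in rows x + a and y + a', and contribute only if these agree.\<close>

lemma sum_pauli_columns: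
  fixes a b a' b' x y :: "'f label"
  assumes fin: "finite A" and xy: "x \<in> labels A" "y \<in> labels A"
  shows "(\<Sum>z\<in>labels A. cnj (pauli A l a b z x) * pauli A l' a' b' z y) =
    (if \<forall>j\<in>A. x j + a j = y j + a' j
     then cnj (omega TYPE('f) ^ l) * omega TYPE('f) ^ l'
       * (\<Prod>j\<in>A. add_char (b' j * y j - b j * x j)) else 0)"
proof -
  let ?x' = "\<lambda>j\<in>A. x j + a j"
  have "(\<forall>j\<in>A. z j = x j + a j) \<longleftrightarrow> z = ?x'" if "z \<in> labels A" for z
    using that by (auto intro!: labels_eqI[of z])
  then have "(\<Sum>z\<in>labels A. cnj (pauli A l a b z x) * pauli A l' a' b' z y)
      = (\<Sum>z\<in>labels A. if z = ?x' then cnj (pauli A l a b ?x' x) * pauli A l' a' b' ?x' y else 0)"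
    by (intro sum.cong) (auto simp: pauli_entry[OF fin])
  also have "\<dots> = cnj (pauli A l a b ?x' x) * pauli A l' a' b' ?x' y"
    using fin by simp
  also have "\<dots> = (if \<forall>j\<in>A. x j + a j = y j + a' j
     then cnj (omega TYPE('f) ^ l) * omega TYPE('f) ^ l'
       * ((\<Prod>j\<in>A. add_char (b' j * y j)) * (\<Prod>j\<in>A. cnj (add_char (b j * x j)))) else 0)"
    using xy by (simp add: pauli_entry[OF fin] mult_ac)
  finally show ?thesis
    by (simp add: add_char_diff prod.distrib)
qed

text \<open>Makes the \<open>THE\<close> in \<open>pauli_label\<close> well defined. The positions
  of the nonzero entries give a, column 0 gives the phase, and columns with a single nonzero
  coordinate then give b through \<open>add_char_separates\<close>.\<close>

lemma pauli_label_unique: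
  fixes a b a' b' :: "'f label"
  assumes fin: "finite A" and lab: "a \<in> labels A" "b \<in> labels A" "a' \<in> labels A" "b' \<in> labels A"
    and eq: "pauli A l a b = pauli A l' a' b'"
  shows "a = a'" "b = b'"
proof -
  have nz: "pauli A l a b (\<lambda>j\<in>A. y j + a j) (restrict y A) \<noteq> 0" for y
  proof -
    have "cmod (pauli A l a b (\<lambda>j\<in>A. y j + a j) (restrict y A)) = 1"
      by (simp add: pauli_entry[OF fin] norm_mult norm_power prod_norm[symmetric])
    then show ?thesis by force
  qed
  show aa: "a = a'"
  proof (rule labels_eqI[OF lab(1,3)])
    fix j assume "j \<in> A"
    then show "a j = a' j"
      using nz[of "\<lambda>_. 0"] unfolding eq by (auto simp: pauli_entry[OF fin] split: if_splits)
  qed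
  have ent: "omega TYPE('f) ^ l * (\<Prod>j\<in>A. add_char (b j * y j))
      = omega TYPE('f) ^ l' * (\<Prod>j\<in>A. add_char (b' j * y j))" for y
    using fun_cong[OF fun_cong[OF eq], of "\<lambda>j\<in>A. y j + a j" "restrict y A"]
    by (simp add: pauli_entry[OF fin] aa cong: prod.cong_simp)
  have phase: "omega TYPE('f) ^ l = omega TYPE('f) ^ l'"
    using ent[of "\<lambda>_. 0"] by simp
  have "omega TYPE('f) \<noteq> 0"
    using cmod_omega[where 'f = 'f] by force
  show "b = b'"
  proof (rule labels_eqI[OF lab(2,4)])
    fix j assume j: "j \<in> A"
    have single: "(\<Prod>i\<in>A. add_char (d i * (if i = j then z else 0))) = add_char (d j * z)"
      for d :: "'f label" and z
    proof -
      have "(\<Prod>i\<in>A. add_char (d i * (if i = j then z else 0))) =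
          (\<Prod>i\<in>A. if i = j then add_char (d j * z) else 1)"
        by (rule prod.cong) auto
      then show ?thesis using fin j by simp
    qed
    show "b j = b' j"
    proof (rule add_char_separates)
      show "add_char (b j * z) = add_char (b' j * z)" for z
        using ent[of "\<lambda>i. if i = j then z else 0"] phase \<open>omega TYPE('f) \<noteq> 0\<close>
        unfolding single by simp
    qed
  qed
qed

lemma pauli_label_pauli:
  fixes a b :: "'f label"
  assumes fin: "finite A" and lab: "a \<in> labels A" "b \<in> labels A" and l: "l < CHAR('f)"
  shows "pauli_label A (pauli A l a b) = (a, b)"
  unfolding pauli_label_def
proof (rule the_equality)
  show "case (a, b) of (a', b') \<Rightarrow> a' \<in> labels A \<and> b' \<in> labels A \<and>
      (\<exists>l'<CHAR('f). pauli A l a b = pauli A l' a' b')"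
    using lab l by auto
  show "w = (a, b)" if "case w of (a', b') \<Rightarrow> a' \<in> labels A \<and> b' \<in> labels A \<and>
      (\<exists>l'<CHAR('f). pauli A l a b = pauli A l' a' b')" for w
    using that pauli_label_unique[OF fin lab] by (cases w) (auto; metis)
qed

lemma pauli_of_label:
  assumes fin: "finite A" and "G \<in> carrier (pauli_group A)"
    and "pauli_label A G = (a, b :: 'f label)"
  shows "a \<in> labels A" "b \<in> labels A" "\<exists>l. G = pauli A l a b"
proof -
  obtain l a' b' where G: "G = pauli A l a' b'" "l < CHAR('f)" "a' \<in> labels A" "b' \<in> labels A"
    using assms(2) by (auto simp: pauli_group_def)
  then have "a' = a" "b' = b"
    using pauli_label_pauli[OF fin G(3,4,2)] assms(3) by auto
  then show "a \<in> labels A" "b \<in> labels A" "\<exists>l. G = pauli A l a b"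
    using G by auto
qed

end

section \<open>Recovery of one qudit\<close>

lemma erasure_single:
  fixes \<rho> :: "'f::finite oper"
  assumes "s \<in> T"
  shows "erasure {s} T \<rho> x y =
    (if x \<in> labels T \<and> y \<in> labels T \<and> x s = y s
     then (\<Sum>w\<in>UNIV. \<rho> (x(s := w)) (y(s := w))) / of_nat CARD('f) else 0)"
proof (cases "x \<in> labels T \<and> y \<in> labels T")
  case True
  have upd: "override_on (restrict v (T - {s})) z {s} = v(s := z s)" if "v \<in> labels T" for v z :: "'f label"
    using that assms by (auto simp: fun_eq_iff override_on_def labels_def PiE_def extensional_def)
  have "(\<Sum>z\<in>labels {s}. \<rho> (x(s := z s)) (y(s := z s))) = (\<Sum>w\<in>UNIV. \<rho> (x(s := w)) (y(s := w)))"
    by (rule sum.reindex_bij_witness[of _ "\<lambda>w. \<lambda>j\<in>{s}. w" "\<lambda>z. z s"])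
      (auto intro: labels_eqI[of _ "{s}"])
  then have "partial_trace {s} T \<rho> (restrict x (T - {s})) (restrict y (T - {s}))
      = (\<Sum>w\<in>UNIV. \<rho> (x(s := w)) (y(s := w)))"
    using True by (simp add: partial_trace_def upd)
  moreover have "restrict x {s} = restrict y {s} \<longleftrightarrow> x s = y s"
    by (metis restrict_apply' restrict_ext singletonD singletonI)
  ultimately show ?thesis
    using True by (simp add: erasure_def op_id_def)
qed (auto simp: erasure_def)

text \<open>\<open>A\<close> will be the register made of Q_i, R and Bob's qudits. Only the labels
  at \<open>i\<close> are prescribed; the phases \<open>l s\<close> and the labels at the other
  sites are arbitrary.\<close>

locale local_checks = finite_field_degree F m
  for F :: "'f::finite_field itself" and m +
  fixes A :: "site set" and i :: site and l :: "'f \<times> 'f \<Rightarrow> nat" and a b :: "'f \<times> 'f \<Rightarrow> 'f label"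
  assumes finite_reg: "finite A" and site_in: "i \<in> A"
    and label_at: "a s i = fst s" "b s i = snd s"
begin

abbreviation check :: "'f \<times> 'f \<Rightarrow> 'f oper" where
  "check s \<equiv> pauli A (l s) (a s) (b s)"

definition avg_check :: "'f oper" where
  "avg_check x y = (\<Sum>s\<in>UNIV. check s x y) / of_nat CARD('f) ^ 2"

text \<open>With \<open>avg_check\<close> as \<Pi>, these are the entries of the Kraus operators of
  the overview: |u><v| at \<open>i\<close> kills the columns that do not read v and rewrites v to u
  in the others.\<close>

definition rec_kraus :: "'f \<times> 'f \<Rightarrow> 'f oper" where
  "rec_kraus = (\<lambda>(u, v) x y. if x \<in> labels A \<and> y \<in> labels A \<and> y i = v
     then of_real (sqrt (real CARD('f))) * avg_check x (y(i := u)) else 0)"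

lemma sqrt_card_square: "complex_of_real (sqrt (real CARD('f))) * complex_of_real (sqrt (real CARD('f))) = of_nat CARD('f)"
  by (simp flip: of_real_mult)

text \<open>An entry of the partial trace over qudit i of the adjoint of \<open>check s\<close>
  times \<open>check t\<close>. Different X parts at \<open>i\<close> leave no matching rows,
  different Z parts give a vanishing character sum, and for s = t unitarity leaves q times the
  identity.\<close>

lemma sum_check_columns:
  assumes xy: "x \<in> labels A" "y \<in> labels A" and xyi: "x i = y i"
  shows "(\<Sum>w\<in>UNIV. \<Sum>z\<in>labels A. cnj (check s z (x(i := w))) * check t z (y(i := w)))
       = (if s = t \<and> x = y then of_nat CARD('f) else 0)"
proof -
  define c where "c = cnj (omega TYPE('f) ^ l s) * omega TYPE('f) ^ l t"
  \<comment> \<open>Both labels read w at \<open>i\<close>, so the matching condition there is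
    \<open>fst s = fst t\<close>, whatever w is.\<close>
  define M where "M \<longleftrightarrow> (\<forall>j\<in>A - {i}. x j + a s j = y j + a t j) \<and> fst s = fst t"
  define d where "d = (\<Prod>j\<in>A - {i}. add_char (b t j * y j - b s j * x j))"
  have cond: "(\<forall>j\<in>A. (x(i := w)) j + a s j = (y(i := w)) j + a t j) \<longleftrightarrow> M" for w
    using site_in by (auto simp: M_def label_at)
  have pr: "(\<Prod>j\<in>A. add_char (b t j * (y(i := w)) j - b s j * (x(i := w)) j))
      = add_char ((snd t - snd s) * w) * d" for w
    using prod.remove[OF finite_reg site_in, of "\<lambda>j. add_char (b t j * (y(i := w)) j - b s j * (x(i := w)) j)"]
    by (simp add: d_def label_at left_diff_distrib)
  have "(\<Sum>w\<in>UNIV. \<Sum>z\<in>labels A. cnj (check s z (x(i := w))) * check t z (y(i := w)))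
      = (\<Sum>w\<in>UNIV. if M then c * d * add_char ((snd t - snd s) * w) else 0)"
    unfolding sum_pauli_columns[OF finite_reg labels_upd[OF xy(1) site_in] labels_upd[OF xy(2) site_in]]
      cond pr by (intro sum.cong) (auto simp: c_def)
  also have "\<dots> = (if M \<and> snd t = snd s then c * d * of_nat CARD('f) else 0)"
    by (cases M) (simp_all add: sum_distrib_left[symmetric] sum_add_char)
  also have "\<dots> = (if s = t \<and> x = y then of_nat CARD('f) else 0)"
  proof (cases "s = t")
    case True
    have "M \<longleftrightarrow> x = y"
      using True xyi by (auto simp: M_def intro!: labels_eqI[OF xy])
    moreover have "c = 1"
      using True complex_norm_square[of "omega TYPE('f) ^ l t"] by (simp add: c_def norm_power mult.commute)
    moreover have "d = 1" if "x = y"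
      using that True by (simp add: d_def)
    ultimately show ?thesis using True by simp
  qed (auto simp: M_def prod_eq_iff)
  finally show ?thesis .
qed

text \<open>The sum over v absorbs the column selection and the sum over u is a partial trace over
  qudit i, so \<open>sum_check_columns\<close> removes all cross terms of \<open>avg_check\<close>
  with its adjoint.\<close>

lemma rec_kraus_complete:
  "(\<Sum>k\<in>UNIV. op_comp (labels A) (op_adj (rec_kraus k)) (rec_kraus k) x y) = op_id (labels A) x y"
proof (cases "x \<in> labels A \<and> y \<in> labels A \<and> x i = y i")
  case False
  then have "op_comp (labels A) (op_adj (rec_kraus k)) (rec_kraus k) x y = 0" for k
    by (auto simp: op_comp_def op_adj_def rec_kraus_def split: prod.splits intro!: sum.neutral)
  then show ?thesis
    using False by (auto simp: op_id_def)
next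
  case True
  then have x: "x \<in> labels A" and y: "y \<in> labels A" and xyi: "x i = y i" by auto
  define q where "q = (of_nat CARD('f) :: complex)"
  have q0: "q \<noteq> 0" by (simp add: q_def)
  have "(\<Sum>k\<in>UNIV. op_comp (labels A) (op_adj (rec_kraus k)) (rec_kraus k) x y)
      = (\<Sum>u\<in>UNIV. \<Sum>v\<in>UNIV. if v = y i
          then q * (\<Sum>z\<in>labels A. cnj (avg_check z (x(i := u))) * avg_check z (y(i := u))) else 0)"
    unfolding UNIV_Times_UNIV[symmetric] sum.cartesian_product'
  proof (intro sum.cong refl)
    fix u v
    have "op_comp (labels A) (op_adj (rec_kraus (u, v))) (rec_kraus (u, v)) x y = (if v = y i
        then \<Sum>z\<in>labels A. (of_real (sqrt (real CARD('f))) * of_real (sqrt (real CARD('f))))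
          * (cnj (avg_check z (x(i := u))) * avg_check z (y(i := u))) else 0)"
      using x y xyi by (simp add: op_comp_def op_adj_def rec_kraus_def mult_ac cong: sum.cong)
    then show "op_comp (labels A) (op_adj (rec_kraus (u, v))) (rec_kraus (u, v)) x y = (if v = y i
        then q * (\<Sum>z\<in>labels A. cnj (avg_check z (x(i := u))) * avg_check z (y(i := u))) else 0)"
      unfolding sqrt_card_square q_def[symmetric] sum_distrib_left[symmetric] .
  qed
  also have "\<dots> = (\<Sum>u\<in>UNIV. q * (\<Sum>z\<in>labels A. cnj (avg_check z (x(i := u))) * avg_check z (y(i := u))))"
    by simp
  also have "\<dots> = (\<Sum>u\<in>UNIV. \<Sum>z\<in>labels A. \<Sum>s\<in>UNIV. \<Sum>t\<in>UNIV.
      cnj (check s z (x(i := u))) * check t z (y(i := u)) / q ^ 3)"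
  proof -
    have "q * (cnj (avg_check z x') * avg_check z y')
        = (\<Sum>s\<in>UNIV. \<Sum>t\<in>UNIV. cnj (check s z x') * check t z y' / q ^ 3)" for x' y' z
    proof -
      have "cnj (avg_check z x') * avg_check z y'
          = (\<Sum>s\<in>UNIV. cnj (check s z x')) * (\<Sum>t\<in>UNIV. check t z y') / q ^ 4"
        by (simp add: avg_check_def q_def)
      then have "q * (cnj (avg_check z x') * avg_check z y')
          = (\<Sum>s\<in>UNIV. cnj (check s z x')) * (\<Sum>t\<in>UNIV. check t z y') / q ^ 3"
        using q0 by (simp add: power4_eq_xxxx power3_eq_cube)
      then show ?thesis
        by (simp only: sum_product sum_divide_distrib)
    qed
    then show ?thesis
      by (simp only: sum_distrib_left)
  qed
  also have "\<dots> = (\<Sum>s\<in>UNIV. \<Sum>t\<in>UNIV. \<Sum>u\<in>UNIV. \<Sum>z\<in>labels A.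
      cnj (check s z (x(i := u))) * check t z (y(i := u)) / q ^ 3)"
  proof -
    have "(\<Sum>u\<in>U. \<Sum>z\<in>Z. \<Sum>s\<in>P. \<Sum>t\<in>R. f u z s t) = (\<Sum>s\<in>P. \<Sum>t\<in>R. \<Sum>u\<in>U. \<Sum>z\<in>Z. f u z s t)"
      for f :: "'a \<Rightarrow> 'b \<Rightarrow> 'c \<Rightarrow> 'd \<Rightarrow> complex" and U Z P R
    proof -
      have "(\<Sum>u\<in>U. \<Sum>z\<in>Z. \<Sum>s\<in>P. \<Sum>t\<in>R. f u z s t) = (\<Sum>(u, z, s, t)\<in>U \<times> Z \<times> P \<times> R. f u z s t)"
        by (simp add: sum.cartesian_product')
      also have "\<dots> = (\<Sum>(s, t, u, z)\<in>P \<times> R \<times> U \<times> Z. f u z s t)"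
        by (rule sum.reindex_bij_witness[of _ "\<lambda>(s, t, u, z). (u, z, s, t)" "\<lambda>(u, z, s, t). (s, t, u, z)"])
          auto
      finally show ?thesis by (simp add: sum.cartesian_product')
    qed
    then show ?thesis .
  qed
  also have "\<dots> = (\<Sum>s\<in>(UNIV :: ('f \<times> 'f) set). \<Sum>t\<in>UNIV. (if s = t \<and> x = y then q else 0) / q ^ 3)"
    by (simp only: sum_divide_distrib[symmetric] sum_check_columns[OF x y xyi] q_def)
  also have "\<dots> = (\<Sum>s\<in>(UNIV :: ('f \<times> 'f) set). if x = y then q / q ^ 3 else 0)"
  proof (rule sum.cong[OF refl])
    fix s :: "'f \<times> 'f"
    have "(\<Sum>t\<in>UNIV. (if s = t \<and> x = y then q else 0) / q ^ 3)
        = (\<Sum>t\<in>UNIV. if s = t then (if x = y then q / q ^ 3 else 0) else 0)"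
      by (rule sum.cong) auto
    then show "(\<Sum>t\<in>UNIV. (if s = t \<and> x = y then q else 0) / q ^ 3) = (if x = y then q / q ^ 3 else 0)"
      by simp
  qed
  \<comment> \<open>There are q^2 indices s, each contributing q / q^3 on the diagonal.\<close>
  also have "\<dots> = op_id (labels A) x y"
    using q0 x by (simp add: op_id_def card_cartesian_product q_def[symmetric] power3_eq_cube flip: UNIV_Times_UNIV)
  finally show ?thesis .
qed

lemma quantum_channel_recovery: "quantum_channel (labels A) (kraus_map (labels A) UNIV rec_kraus)"
proof (rule quantum_channel_kraus_map)
  show "rec_kraus k \<in> ops (labels A)" for k
    by (auto simp: rec_kraus_def ops_def split: prod.splits)
qed (auto simp: finite_reg rec_kraus_complete)

text \<open>As \<open>check s\<close> fixes \<phi>, applying it after |u><w| amounts to conjugating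
  |u><w| by it. This shifts u and w by \<open>fst s\<close> and yields the phase
  \<open>add_char (snd s * (u - w))\<close>; the rest of the check cancels.\<close>

lemma check_shifted:
  assumes fixed: "op_apply (labels A) (check s) \<phi> = \<phi>" and x: "x \<in> labels A"
  shows "(\<Sum>y\<in>labels A. if y i = u then check s x y * \<phi> (y(i := w)) else 0)
       = (if fst s = x i - u then add_char (snd s * (u - w)) * \<phi> (x(i := w + (x i - u))) else 0)"
proof -
  let ?y = "\<lambda>j\<in>A. x j - a s j" and ?x' = "x(i := w + fst s)"
  define d where "d = (\<Prod>j\<in>A - {i}. add_char (b s j * (x j - a s j)))"
  have "(\<Sum>y\<in>labels A. if y i = u then check s x y * \<phi> (y(i := w)) else 0)
      = op_apply (labels A) (check s) (\<lambda>y. if y i = u then \<phi> (y(i := w)) else 0) x"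
    by (auto simp: op_apply_def intro: sum.cong)
  also have "\<dots> = (if fst s = x i - u then
      omega TYPE('f) ^ l s * (add_char (snd s * u) * d) * \<phi> (?y(i := w)) else 0)"
  proof -
    have "(\<Prod>j\<in>A. add_char (b s j * (x j - a s j))) = add_char (snd s * (x i - fst s)) * d"
      using prod.remove[OF finite_reg site_in, of "\<lambda>j. add_char (b s j * (x j - a s j))"]
      by (simp only: label_at d_def)
    moreover have "?y i = x i - fst s"
      using site_in by (simp add: label_at)
    moreover have "x i - fst s = u \<longleftrightarrow> fst s = x i - u"
      by (auto simp: algebra_simps)
    ultimately show ?thesis
      unfolding op_apply_pauli[OF finite_reg x] by simp
  qed
  also have "\<dots> = (if fst s = x i - u then add_char (snd s * (u - w)) * \<phi> ?x' else 0)"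
  proof -
    have "(\<lambda>j\<in>A. ?x' j - a s j) = ?y(i := w)"
      using site_in by (auto simp: label_at fun_eq_iff)
    moreover have "(\<Prod>j\<in>A. add_char (b s j * (?x' j - a s j))) = add_char (snd s * w) * d"
      using prod.remove[OF finite_reg site_in, of "\<lambda>j. add_char (b s j * (?x' j - a s j))"]
      by (simp add: label_at d_def)
    \<comment> \<open>The fixed-point equation at \<open>?x'\<close> contains the same
      \<open>d\<close> and the same argument of \<phi> as the term to be rewritten, so only the
      characters at \<open>i\<close> have to be compared.\<close>
    ultimately have \<phi>_x': "\<phi> ?x' = omega TYPE('f) ^ l s * (add_char (snd s * w) * d) * \<phi> (?y(i := w))"
      using op_apply_pauli[OF finite_reg labels_upd[OF x site_in], of "l s" "a s" "b s" \<phi> "w + fst s"]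
      by (simp add: fixed)
    have "add_char (snd s * (u - w)) * \<phi> ?x' = omega TYPE('f) ^ l s
        * ((add_char (snd s * (u - w)) * add_char (snd s * w)) * d) * \<phi> (?y(i := w))"
      unfolding \<phi>_x' by (simp only: mult_ac)
    also have "add_char (snd s * (u - w)) * add_char (snd s * w) = add_char (snd s * u)"
      by (simp add: algebra_simps flip: add_char_add)
    finally have *: "add_char (snd s * (u - w)) * \<phi> ?x' = omega TYPE('f) ^ l s
        * (add_char (snd s * u) * d) * \<phi> (?y(i := w))" .
    show ?thesis unfolding * ..
  qed
  finally show ?thesis by auto
qed

text \<open>Since every \<open>P\<^sub>s\<close> fixes \<open>\<phi>\<close>, \<open>\<Pi> |u\<rangle>\<langle>w|\<^sub>i \<phi>\<close> is the average of \<open>P\<^sub>s |u\<rangle>\<langle>w|\<^sub>i P\<^sub>s\<^sup>\<dagger> \<phi>\<close>, a full Pauli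
  twirl of \<open>|u\<rangle>\<langle>w|\<close> on qudit \<open>i\<close>.\<close>

lemma avg_check_shifted:
  assumes fixed: "\<And>s. op_apply (labels A) (check s) \<phi> = \<phi>" and x: "x \<in> labels A"
  shows "(\<Sum>y\<in>labels A. if y i = u then avg_check x y * \<phi> (y(i := w)) else 0)
       = (if u = w then \<phi> x / of_nat CARD('f) else 0)"
proof -
  define q where "q = (of_nat CARD('f) :: complex)"
  have q0: "q \<noteq> 0" by (simp add: q_def)
  have "(\<Sum>y\<in>labels A. if y i = u then avg_check x y * \<phi> (y(i := w)) else 0)
      = (\<Sum>y\<in>labels A. \<Sum>s\<in>UNIV. (if y i = u then check s x y * \<phi> (y(i := w)) else 0) / q\<^sup>2)"
    by (rule sum.cong) (auto simp: avg_check_def sum_divide_distrib sum_distrib_right q_def)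
  also have "\<dots> = (\<Sum>s\<in>UNIV. (\<Sum>y\<in>labels A. if y i = u then check s x y * \<phi> (y(i := w)) else 0) / q\<^sup>2)"
    by (subst sum.swap) (simp add: sum_divide_distrib)
  also have "\<dots> = (\<Sum>\<alpha>\<in>UNIV. \<Sum>\<beta>\<in>UNIV. (if \<alpha> = x i - u
      then add_char (\<beta> * (u - w)) * \<phi> (x(i := w + (x i - u))) else 0) / q\<^sup>2)"
    unfolding check_shifted[OF fixed x] UNIV_Times_UNIV[symmetric] sum.cartesian_product'
    by (intro sum.cong) auto
  also have "\<dots> = (\<Sum>\<alpha>\<in>UNIV. if \<alpha> = x i - u
      then (\<Sum>\<beta>\<in>UNIV. add_char ((u - w) * \<beta>)) * \<phi> (x(i := w + (x i - u))) / q\<^sup>2 else 0)"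
    by (rule sum.cong) (auto simp: sum_distrib_right sum_divide_distrib mult_ac)
  also have "\<dots> = (\<Sum>\<beta>\<in>UNIV. add_char ((u - w) * \<beta>)) * \<phi> (x(i := w + (x i - u))) / q\<^sup>2"
    by simp
  \<comment> \<open>For u = w the overwritten label is x itself, and the character sum q cancels one
    of the two factors q.\<close>
  also have "\<dots> = (if u = w then \<phi> x / q else 0)"
    using q0 by (auto simp: sum_add_char power2_eq_square q_def)
  finally show ?thesis by (simp add: q_def)
qed

text \<open>Two vectors are needed because a block of |\<psi>><\<psi>| with different row and column
  coordinates outside \<open>A\<close> has the form |\<phi>><\<chi>|.\<close>

lemma recovery_fixed:
  assumes \<phi>: "\<And>s. op_apply (labels A) (check s) \<phi> = \<phi>" and \<chi>: "\<And>s. op_apply (labels A) (check s) \<chi> = \<chi>"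
    and x: "x \<in> labels A" and y: "y \<in> labels A"
  shows "kraus_map (labels A) UNIV rec_kraus (erasure {i} A (\<lambda>x y. \<phi> x * cnj (\<chi> y))) x y = \<phi> x * cnj (\<chi> y)"
proof -
  define q where "q = (of_nat CARD('f) :: complex)"
  have q0: "q \<noteq> 0" by (simp add: q_def)
  let ?D = "labels A :: 'f label set"
  \<comment> \<open>The Kraus operators select v and write u; \<open>sum_labels_coord\<close> brings
    this into the form of \<open>avg_check_shifted\<close>, where u is selected.\<close>
  have col: "(\<Sum>\<xi>\<in>?D. if \<xi> i = v then avg_check x (\<xi>(i := u)) * \<phi> (\<xi>(i := w)) else 0) = (if u = w then \<phi> x / q else 0)"
    if "\<And>s. op_apply (labels A) (check s) \<phi> = \<phi>" "x \<in> ?D" for \<phi> x u v w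
    using sum_labels_coord[OF site_in, of v "\<lambda>z z'. avg_check x z * \<phi> z'" u w] avg_check_shifted[OF that]
    by (simp add: q_def)
  have "kraus_map ?D UNIV rec_kraus (erasure {i} A (\<lambda>x y. \<phi> x * cnj (\<chi> y))) x y
      = (\<Sum>u\<in>UNIV. \<Sum>v\<in>UNIV. \<Sum>\<xi>\<in>?D. \<Sum>\<eta>\<in>?D. \<Sum>w\<in>UNIV.
          (if \<xi> i = v then avg_check x (\<xi>(i := u)) * \<phi> (\<xi>(i := w)) else 0)
          * cnj (if \<eta> i = v then avg_check y (\<eta>(i := u)) * \<chi> (\<eta>(i := w)) else 0))"
    unfolding kraus_map_def UNIV_Times_UNIV[symmetric] sum.cartesian_product'
  proof (intro sum.cong refl)
    fix u v :: 'f and \<xi> \<eta> :: "'f label" assume \<xi>: "\<xi> \<in> ?D" and \<eta>: "\<eta> \<in> ?D"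
    show "rec_kraus (u, v) x \<xi> * erasure {i} A (\<lambda>x y. \<phi> x * cnj (\<chi> y)) \<xi> \<eta> * cnj (rec_kraus (u, v) y \<eta>)
      = (\<Sum>w\<in>UNIV. (if \<xi> i = v then avg_check x (\<xi>(i := u)) * \<phi> (\<xi>(i := w)) else 0)
          * cnj (if \<eta> i = v then avg_check y (\<eta>(i := u)) * \<chi> (\<eta>(i := w)) else 0))"
    proof (cases "\<xi> i = v \<and> \<eta> i = v")
      case True
      let ?r = "complex_of_real (sqrt (real CARD('f)))"
      let ?e = "avg_check x (\<xi>(i := u)) * cnj (avg_check y (\<eta>(i := u)))"
      let ?f = "\<lambda>w. \<phi> (\<xi>(i := w)) * cnj (\<chi> (\<eta>(i := w)))"
      have "rec_kraus (u, v) x \<xi> * erasure {i} A (\<lambda>x y. \<phi> x * cnj (\<chi> y)) \<xi> \<eta> * cnj (rec_kraus (u, v) y \<eta>)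
          = (?r * ?r) * (?e * (\<Sum>w\<in>UNIV. ?f w)) / q"
        using True x y \<xi> \<eta> by (simp add: rec_kraus_def erasure_single[OF site_in] q_def mult_ac)
      \<comment> \<open>The two square roots of q cancel the 1/q of the erasure.\<close>
      also have "\<dots> = ?e * (\<Sum>w\<in>UNIV. ?f w)"
        unfolding sqrt_card_square q_def[symmetric] using q0 by simp
      also have "\<dots> = (\<Sum>w\<in>UNIV. ?e * ?f w)"
        by (rule sum_distrib_left)
      finally show ?thesis
        using True by (simp add: mult_ac)
    qed (auto simp: rec_kraus_def)
  qed
  also have "\<dots> = (\<Sum>u\<in>UNIV. \<Sum>v\<in>UNIV. \<Sum>w\<in>UNIV.
          (\<Sum>\<xi>\<in>?D. if \<xi> i = v then avg_check x (\<xi>(i := u)) * \<phi> (\<xi>(i := w)) else 0)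
          * cnj (\<Sum>\<eta>\<in>?D. if \<eta> i = v then avg_check y (\<eta>(i := u)) * \<chi> (\<eta>(i := w)) else 0))"
  proof (intro sum.cong refl)
    fix u v :: 'f
    have "(\<Sum>\<xi>\<in>?D. \<Sum>\<eta>\<in>?D. \<Sum>w\<in>UNIV. f \<xi> w * cnj (g \<eta> w)) = (\<Sum>w\<in>UNIV. (\<Sum>\<xi>\<in>?D. f \<xi> w) * cnj (\<Sum>\<eta>\<in>?D. g \<eta> w))"
      for f g :: "'f label \<Rightarrow> 'f \<Rightarrow> complex"
    proof -
      have "(\<Sum>\<xi>\<in>?D. \<Sum>\<eta>\<in>?D. \<Sum>w\<in>UNIV. f \<xi> w * cnj (g \<eta> w)) = (\<Sum>\<xi>\<in>?D. \<Sum>w\<in>UNIV. \<Sum>\<eta>\<in>?D. f \<xi> w * cnj (g \<eta> w))"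
        by (rule sum.cong[OF refl], rule sum.swap)
      also have "\<dots> = (\<Sum>w\<in>UNIV. \<Sum>\<xi>\<in>?D. \<Sum>\<eta>\<in>?D. f \<xi> w * cnj (g \<eta> w))"
        by (rule sum.swap)
      finally show ?thesis by (simp add: sum_product)
    qed
    then show "(\<Sum>\<xi>\<in>?D. \<Sum>\<eta>\<in>?D. \<Sum>w\<in>UNIV.
          (if \<xi> i = v then avg_check x (\<xi>(i := u)) * \<phi> (\<xi>(i := w)) else 0)
          * cnj (if \<eta> i = v then avg_check y (\<eta>(i := u)) * \<chi> (\<eta>(i := w)) else 0))
        = (\<Sum>w\<in>UNIV. (\<Sum>\<xi>\<in>?D. if \<xi> i = v then avg_check x (\<xi>(i := u)) * \<phi> (\<xi>(i := w)) else 0)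
          * cnj (\<Sum>\<eta>\<in>?D. if \<eta> i = v then avg_check y (\<eta>(i := u)) * \<chi> (\<eta>(i := w)) else 0))" .
  qed
  also have "\<dots> = (\<Sum>u\<in>(UNIV :: 'f set). \<Sum>v\<in>(UNIV :: 'f set). \<Sum>w\<in>UNIV. if u = w then \<phi> x / q * cnj (\<chi> y / q) else 0)"
    unfolding col[OF \<phi> x] col[OF \<chi> y] by (intro sum.cong refl) auto
  \<comment> \<open>Only w = u survives, and the q^2 pairs (u, v) contribute equally.\<close>
  also have "\<dots> = q * q * (\<phi> x / q * cnj (\<chi> y / q))"
    by (simp add: q_def)
  also have "\<dots> = \<phi> x * cnj (\<chi> y)"
    using q0 by (simp add: q_def)
  finally show ?thesis .
qed

end

section \<open>From the local register to the full one\<close>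

definition ket_slice :: "site set \<Rightarrow> 'f label \<Rightarrow> 'f ket \<Rightarrow> 'f ket" where
  "ket_slice A x \<psi> = (\<lambda>a. if a \<in> labels A then \<psi> (override_on x a A) else 0)"

lemma override_on_labels: "x \<in> labels T \<Longrightarrow> a \<in> labels A \<Longrightarrow> A \<subseteq> T \<Longrightarrow> override_on x a A \<in> labels T"
  by (auto simp: labels_def PiE_def extensional_def override_on_def)

lemma ket_slice_restrict:
  assumes "A \<subseteq> T"
  shows "ket_slice A x \<psi> (restrict x A) = \<psi> x"
proof -
  have "override_on x (restrict x A) A = x"
    by (auto simp: override_on_def)
  then show ?thesis by (simp add: ket_slice_def)
qed

context finite_field_degree
begin

text \<open>A slice is the partial inner product of \<psi> with the basis ket of x outside
  \<open>A\<close>. A Pauli with trivial label there acts as a Pauli on \<open>A\<close> tensored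
  with the identity, so it commutes with slicing.\<close>

lemma ket_slice_fixed:
  fixes a b :: "'f label"
  assumes fin: "finite T" and sub: "A \<subseteq> T" and x: "x \<in> labels T"
    and triv: "\<And>j. j \<in> T - A \<Longrightarrow> a j = 0" "\<And>j. j \<in> T - A \<Longrightarrow> b j = 0"
    and fixed: "op_apply (labels T) (pauli T l a b) \<psi> = \<psi>"
  shows "op_apply (labels A) (pauli A l a b) (ket_slice A x \<psi>) = ket_slice A x \<psi>"
proof
  fix z
  have finA: "finite A"
    using sub fin by (rule finite_subset)
  show "op_apply (labels A) (pauli A l a b) (ket_slice A x \<psi>) z = ket_slice A x \<psi> z"
  proof (cases "z \<in> labels A")
    case False
    then show ?thesis
      by (simp add: op_apply_def pauli_entry[OF finA] ket_slice_def)
  next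
    case True
    let ?X = "override_on x z A"
    have "(\<Prod>j\<in>T. add_char (b j * (?X j - a j))) = (\<Prod>j\<in>A. add_char (b j * (z j - a j)))"
      using fin sub triv by (intro prod.mono_neutral_cong_right) (auto simp: override_on_def)
    moreover have "override_on x (\<lambda>j\<in>A. z j - a j) A = (\<lambda>j\<in>T. ?X j - a j)"
      using sub x triv by (auto simp: override_on_def fun_eq_iff labels_def PiE_def extensional_def)
    ultimately show ?thesis
      using op_apply_pauli[OF fin override_on_labels[OF x True sub], of l a b \<psi>] True
      by (simp add: op_apply_pauli[OF finA True] ket_slice_def fixed)
  qed
qed

text \<open>\<open>tensor_rest\<close> acts block by block, and each block of |\<psi>><\<psi>| is
  built from two slices fixed by all checks, so \<open>recovery_fixed\<close> restores it.\<close>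

lemma recovery_set_if_checks:
  fixes C :: "'f ket set"
  assumes i: "i \<in> {1..n}" and R: "R \<subseteq> {1..n} - {i}"
    and label_at: "\<And>s. a s (Sent i) = fst s" "\<And>s. b s (Sent i) = snd s"
    and triv: "\<And>s j. j \<in> {1..n} - insert i R \<Longrightarrow> a s (Sent j) = 0"
      "\<And>s j. j \<in> {1..n} - insert i R \<Longrightarrow> b s (Sent j) = 0"
    and fixed: "\<And>s \<psi>. \<psi> \<in> C \<Longrightarrow>
      op_apply (labels (full_reg n c)) (pauli (full_reg n c) (l s) (a s) (b s)) \<psi> = \<psi>"
  shows "recovery_set n c C i R"
proof -
  define T where "T = full_reg n c"
  define A where "A = Sent ` ({i} \<union> R) \<union> bob_reg c"
  have finT: "finite T"
    by (simp add: T_def full_reg_def sent_reg_def bob_reg_def)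
  have sub: "A \<subseteq> T"
    using i R by (auto simp: A_def T_def full_reg_def sent_reg_def)
  have iA: "Sent i \<in> A" and iT: "Sent i \<in> T"
    using sub by (auto simp: A_def)
  \<comment> \<open>\<open>pauli A\<close> reads its labels only on \<open>A\<close>, so the labels
    for the full register are used unchanged.\<close>
  interpret local_checks F m A "Sent i" l a b
    using finite_subset[OF sub finT] iA label_at by unfold_locales auto
  have "T - A \<subseteq> Sent ` ({1..n} - insert i R)"
    by (auto simp: A_def T_def full_reg_def sent_reg_def)
  then have triv': "a s j = 0" "b s j = 0" if "j \<in> T - A" for s j
    using that triv by blast+
  have "tensor_rest A T (kraus_map (labels A) UNIV rec_kraus) (erasure {Sent i} T (rank_one \<psi>)) = rank_one \<psi>"
    if \<psi>: "\<psi> \<in> C" "unit_vec (labels T) \<psi>" for \<psi>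
  proof (intro ext)
    fix x y
    show "tensor_rest A T (kraus_map (labels A) UNIV rec_kraus) (erasure {Sent i} T (rank_one \<psi>)) x y = rank_one \<psi> x y"
    proof (cases "x \<in> labels T \<and> y \<in> labels T")
      case True
      let ?\<phi> = "ket_slice A x \<psi>" and ?\<chi> = "ket_slice A y \<psi>"
      \<comment> \<open>Since \<open>Sent i\<close> lies in \<open>A\<close>, erasing it commutes
        with taking the block.\<close>
      have "(\<lambda>u v. if u \<in> labels A \<and> v \<in> labels A
            then erasure {Sent i} T (rank_one \<psi>) (override_on x u A) (override_on y v A) else 0)
          = erasure {Sent i} A (\<lambda>u v. ?\<phi> u * cnj (?\<chi> v))"
      proof (intro ext)
        fix u v
        have "(override_on z t A)(Sent i := w) = override_on z (t(Sent i := w)) A" for z t :: "'f label" and w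
          using iA by (auto simp: override_on_def fun_eq_iff)
        moreover have "override_on z t A (Sent i) = t (Sent i)" for z t :: "'f label"
          using iA by simp
        ultimately show "(if u \<in> labels A \<and> v \<in> labels A
            then erasure {Sent i} T (rank_one \<psi>) (override_on x u A) (override_on y v A) else 0)
          = erasure {Sent i} A (\<lambda>u v. ?\<phi> u * cnj (?\<chi> v)) u v"
          using True sub
          by (auto simp: erasure_single[OF iA] erasure_single[OF iT] override_on_labels rank_one_def
              ket_slice_def labels_upd[OF _ iA])
      qed
      moreover have "rank_one \<psi> x y = \<psi> x * cnj (\<psi> y)"
        by (simp add: rank_one_def)
      ultimately show ?thesis
        using True recovery_fixed[OF ket_slice_fixed[OF finT sub _ triv' fixed[OF \<psi>(1), folded T_def]]
            ket_slice_fixed[OF finT sub _ triv' fixed[OF \<psi>(1), folded T_def]], of x y "restrict x A" "restrict y A"]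
        by (simp add: tensor_rest_def ket_slice_restrict[OF sub])
    next
      case False
      then show ?thesis
        using \<psi>(2) by (auto simp: tensor_rest_def rank_one_def unit_vec_def vecs_def)
    qed
  qed
  then show ?thesis
    unfolding recovery_set_def A_def[symmetric] T_def[symmetric]
    using R quantum_channel_recovery by blast
qed

end

theorem theorem1:
  fixes p m n k \<delta> c :: nat and r :: int
    and S :: "'f::finite_field oper set" and C :: "'f ket set"
  assumes "prime p" and "CARD('f) = p ^ m"
    and "EASC n k \<delta> c S C"
    and "Fq_linear (full_reg n c) (pauli_label (full_reg n c) ` S)"
    and "\<forall>i\<in>{1..n}. \<exists>G\<in>S. \<exists>K\<in>S. \<exists>a b u v.
           pauli_label (full_reg n c) G = (a, b) \<and>
           pauli_label (full_reg n c) K = (u, v) \<and>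
           (a (Sent i), b (Sent i)) = (1, 0) \<and>
           (u (Sent i), v (Sent i)) = (0, 1) \<and>
           int (card ((supp_Q n c G \<union> supp_Q n c K) - {i})) \<le> r"
  shows "EAQLRC n k \<delta> c r C"
proof -
  interpret finite_field_degree "TYPE('f)" m
    using assms(2) CHAR_eq_if_CARD_prime_power[OF assms(1,2)] by unfold_locales simp
  define T where "T = full_reg n c"
  let ?L = "pauli_label T ` S"
  have finT: "finite T"
    by (simp add: T_def full_reg_def sent_reg_def bob_reg_def)
  have S: "S \<subseteq> carrier (pauli_group T)"
    using assms(3) by (auto simp: EASC_def T_def dest: subgroup.subset)
  have C: "op_apply (labels T) G \<psi> = \<psi>" if "\<psi> \<in> C" "G \<in> S" for \<psi> G
    using assms(3) that by (auto simp: EASC_def T_def)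
  have add: "((\<lambda>j\<in>T. a j + a' j), (\<lambda>j\<in>T. b j + b' j)) \<in> ?L" if "(a, b) \<in> ?L" "(a', b') \<in> ?L" for a b a' b'
    using assms(4) that unfolding Fq_linear_def T_def by blast
  have scale: "((\<lambda>j\<in>T. t * a j), (\<lambda>j\<in>T. t * b j)) \<in> ?L" if "(a, b) \<in> ?L" for a b t
    using assms(4) that unfolding Fq_linear_def T_def by blast
  have "\<exists>R. recovery_set n c C i R \<and> int (card R) \<le> r" if i: "i \<in> {1..n}" for i
  proof -
    obtain G K a b u v where GK: "G \<in> S" "K \<in> S" "pauli_label T G = (a, b)" "pauli_label T K = (u, v)"
      and at: "a (Sent i) = 1" "b (Sent i) = 0" "u (Sent i) = 0" "v (Sent i) = 1"
      and card: "int (card ((supp_Q n c G \<union> supp_Q n c K) - {i})) \<le> r"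
      using assms(5) i unfolding T_def by blast
    define R where "R = (supp_Q n c G \<union> supp_Q n c K) - {i}"
    \<comment> \<open>\<open>A s\<close> and \<open>B s\<close> form the combination of the labels
      of \<open>G\<close> and \<open>K\<close> with coefficients s; by the values (1, 0) and (0, 1)
      at \<open>Sent i\<close> it reads s there.\<close>
    define A where "A s = (\<lambda>j\<in>T. fst s * a j + snd s * u j)" for s
    define B where "B s = (\<lambda>j\<in>T. fst s * b j + snd s * v j)" for s
    have "\<exists>l. pauli T l (A s) (B s) \<in> S" for s
    proof -
      have "(\<lambda>j\<in>T. (\<lambda>j\<in>T. x * f j) j + (\<lambda>j\<in>T. y * g j) j) = (\<lambda>j\<in>T. x * f j + y * g j)"
        for x y :: 'f and f g
        by auto
      then have "(A s, B s) \<in> ?L"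
        using add[OF scale[of a b "fst s"] scale[of u v "snd s"]] GK by (force simp: A_def B_def)
      then obtain H where "H \<in> S" "pauli_label T H = (A s, B s)" by auto
      then show ?thesis
        using pauli_of_label(3)[OF finT] S by blast
    qed
    \<comment> \<open>Linearity concerns labels only, so a stabilizer with label
      \<open>(A s, B s)\<close> comes with some phase, chosen here for every s.\<close>
    then obtain l where l: "\<And>s. pauli T (l s) (A s) (B s) \<in> S" by metis
    have iT: "Sent j \<in> T" if "j \<in> {1..n}" for j
      using that by (auto simp: T_def full_reg_def sent_reg_def)
    have zero: "a (Sent j) = 0 \<and> b (Sent j) = 0 \<and> u (Sent j) = 0 \<and> v (Sent j) = 0"
      if "j \<in> {1..n} - insert i R" for j
      using that GK(3,4) by (auto simp: R_def supp_Q_def T_def)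
    have "recovery_set n c C i R"
    proof (rule recovery_set_if_checks[OF i, of R A B C c l])
      show "R \<subseteq> {1..n} - {i}"
        by (auto simp: R_def supp_Q_def split: prod.splits)
      show "A s (Sent i) = fst s" "B s (Sent i) = snd s" for s
        using iT[OF i] at by (auto simp: A_def B_def)
      show "A s (Sent j) = 0" "B s (Sent j) = 0" if "j \<in> {1..n} - insert i R" for s j
        using iT[of j] zero[OF that] that by (auto simp: A_def B_def)
    qed (use C l in \<open>simp add: T_def\<close>)
    then show ?thesis using card by (auto simp: R_def)
  qed
  then show ?thesis
    using assms(3) by (auto simp: EAQLRC_def EASC_def)
qed

end
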